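(* Suppose $N=\Gamma\times H_D$ is torsion-free, and fix $f\in\mathrm{Aut}(N)$. Write $\theta(f)=M\in\mathbf{M}$ for the image of $f$ under the homomorphism $\theta\colon\mathrm{Aut}(N)\to\mathbf{M}$ induced by abelianisation. Then there exists $\varepsilon\in\{1,-1\}$ and a polynomial function $\gamma\colon\mathbb{R}^{2r+s}\to\mathbb{R}$ of degree $2$, with $\gamma(0,\ldots,0)=0$, restricting to a function $\mathbb{Z}^{2r+s}\to\mathbb{Z}$, such that for each element $z_1^{l_1}\cdots z_s^{l_s}a_1^{i_1}b_1^{j_1}\cdots a_r^{i_r}b_r^{j_r}c^k\in N$ we have \[f\left(z_1^{l_1}\cdots z_s^{l_s}a_1^{i_1}b_1^{j_1}\cdots a_r^{i_r}b_r^{j_r}c^k\right)=\left(\overline{z_1^{l_1}\cdots z_s^{l_s}a_1^{i_1}b_1^{j_1}\cdots a_r^{i_r}b_r^{j_r}}\,M\right)^{\wedge}c^{\varepsilon k+\gamma(l_1,\ldots,l_s,i_1,j_1,\ldots,i_r,j_r)}\] \[=\left((l_1,\ldots,l_s,i_1,j_1,\ldots,i_r,j_r)M\right)^{\wedge}c^{\varepsilon k+\gamma(l_1,\ldots,l_s,i_1,j_1,\ldots,i_r,j_r)},\] with $\varepsilon$ and $\gamma$ depending only on $f$.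
   Context: Notation: $[g,h]=ghg^{-1}h^{-1}$; $\mathbb{N}_+$ is the set of positive integers. The group $H_D$: let $H_1=\langle a,b\mid [[a,b],a],[[a,b],b]\rangle$. Take $r\geq 1$ copies of $H_1$, the $i$-th generated by $a_i,b_i$, with $c_i=[a_i,b_i]$. For $D=(\delta_1,\ldots,\delta_{r-1})\in(\mathbb{N}_+)^{r-1}$ with $\delta_i\mid\delta_{i+1}$ for each $i$, $H_D$ is the quotient of the direct product of the $r$ copies by the central subgroup generated by $c_ic_1^{-\delta_{i-1}}$, $2\leq i\leq r$ (for $r=1$, $H_D=H_1$). Write $c=c_1$. $\Gamma$ is a finitely generated abelian group of torsion-free rank $s$; when $\Gamma\times H_D$ is torsion-free, $\Gamma\cong\mathbb{Z}^s$ and a basis $\{z_1,\ldots,z_s\}$ of $\Gamma$ is chosen. Every element of $N=\Gamma\times H_D$ is then uniquely of the form $z_1^{l_1}\cdots z_s^{l_s}a_1^{i_1}b_1^{j_1}\cdots a_r^{i_r}b_r^{j_r}c^k$ with integer exponents (Mal'cev normal form). The derived subgroup of $N$ is $\langle c\rangle$. For $g\in N$, $\bar g$ is its image in the abelianisation $\mathrm{Ab}(N)=N/\langle c\rangle$, which is identified with $\mathbb{Z}^{2r+s}$ (row vectors, on which matrices act on the right) via the basis $\bar z_1,\ldots,\bar z_s,\bar a_1,\bar b_1,\ldots,\bar a_r,\bar b_r$. The canonical lift of $x=(l_1,\ldots,l_s,i_1,j_1,\ldots,i_r,j_r)\in\mathrm{Ab}(N)$ is $x^{\wedge}=z_1^{l_1}\cdots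 z_s^{l_s}a_1^{i_1}b_1^{j_1}\cdots a_r^{i_r}b_r^{j_r}\in N$. The group $\mathbf{M}$: let $\Omega_r$ be the $2r\times 2r$ block diagonal matrix with diagonal blocks $\begin{pmatrix}0&1\\-1&0\end{pmatrix}$ and zeroes elsewhere, and let $\Omega_{r,s}$ be the $(2r+s)\times(2r+s)$ matrix with $\Omega_r$ in the bottom right corner and zeroes elsewhere. Then $\mathbf{M}<\mathrm{GL}_{2r+s}(\mathbb{Z})$ is the group of matrices $M$ such that $M\Omega_{r,s}M^T=\varepsilon'\Omega_{r,s}$ for some $\varepsilon'\in\{1,-1\}$. The map $\theta\colon\mathrm{Aut}(N)\to\mathbf{M}$ is the epimorphism induced by the natural homomorphism $N\to\mathrm{Ab}(N)$, sending an automorphism of $N$ to the matrix of the automorphism it induces on $\mathrm{Ab}(N)\cong\mathbb{Z}^{2r+s}$. *)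

theory Defs
  imports
    "HOL-Algebra.Algebra"
    "Jordan_Normal_Form.Matrix"
begin

section \<open>Groups given by generators and relators\<close>

text \<open>A letter \<open>(x, False)\<close> stands for the generator \<open>x\<close>, and \<open>(x, True)\<close> for its inverse.\<close>

type_synonym 'x gword = "('x \<times> bool) list"

definition gw_inv :: "'x gword \<Rightarrow> 'x gword" where
  "gw_inv w = rev (map (\<lambda>(x, e). (x, \<not> e)) w)"

definition gw_comm :: "'x gword \<Rightarrow> 'x gword \<Rightarrow> 'x gword" where
  "gw_comm u v = u @ v @ gw_inv u @ gw_inv v"

text \<open>The congruence on words generated by free cancellation and by deletion of relators from \<open>R\<close>.\<close>

inductive gw_eq :: "'x gword set \<Rightarrow> 'x gword \<Rightarrow> 'x gword \<Rightarrow> bool" for R where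
  refl: "gw_eq R u u"
| sym: "gw_eq R u v \<Longrightarrow> gw_eq R v u"
| trans: "gw_eq R u v \<Longrightarrow> gw_eq R v w \<Longrightarrow> gw_eq R u w"
| cancel: "gw_eq R (u @ [(x, e), (x, \<not> e)] @ v) (u @ v)"
| relator: "\<rho> \<in> R \<Longrightarrow> gw_eq R (u @ \<rho> @ v) (u @ v)"

definition gw_class :: "'x gword set \<Rightarrow> 'x gword \<Rightarrow> 'x gword set" where
  "gw_class R u = {v. gw_eq R u v}"

text \<open>The group presented by all elements of the type \<open>'x\<close> as generators and by the relators \<open>R\<close>.\<close>

definition presented_group :: "'x gword set \<Rightarrow> 'x gword set monoid" where
  "presented_group R =
    \<lparr>carrier = range (gw_class R),
     monoid.mult = (\<lambda>A B. {w. \<exists>u\<in>A. \<exists>v\<in>B. gw_eq R (u @ v) w}),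
     one = gw_class R []\<rparr>"


section \<open>The groups \<open>H\<^sub>D\<close> and \<open>\<Gamma> \<times> H\<^sub>D\<close>\<close>

definition commutator :: "('a, 'm) monoid_scheme \<Rightarrow> 'a \<Rightarrow> 'a \<Rightarrow> 'a" where
  "commutator G g h = g \<otimes>\<^bsub>G\<^esub> h \<otimes>\<^bsub>G\<^esub> inv\<^bsub>G\<^esub> g \<otimes>\<^bsub>G\<^esub> inv\<^bsub>G\<^esub> h"

datatype heis_gen = GenA | GenB

definition H1_relators :: "heis_gen gword set" where
  "H1_relators =
    {gw_comm (gw_comm [(GenA, False)] [(GenB, False)]) [(GenA, False)],
     gw_comm (gw_comm [(GenA, False)] [(GenB, False)]) [(GenB, False)]}"

definition H1 :: "heis_gen gword set monoid" where
  "H1 = presented_group H1_relators"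

definition H1_gen :: "heis_gen \<Rightarrow> heis_gen gword set" where
  "H1_gen x = gw_class H1_relators [(x, False)]"

text \<open>The \<open>r\<close> copies of \<open>H\<^sub>1\<close> are indexed by \<open>{1..r}\<close>; \<open>copy_gen r i x\<close> is the generator \<open>x\<close> of
  the \<open>i\<close>-th copy inside the direct product.\<close>

type_synonym heis_tuple = "nat \<Rightarrow> heis_gen gword set"

definition H1_power :: "nat \<Rightarrow> heis_tuple monoid" where
  "H1_power r = product_group {1..r} (\<lambda>_. H1)"

definition copy_gen :: "nat \<Rightarrow> nat \<Rightarrow> heis_gen \<Rightarrow> heis_tuple" where
  "copy_gen r i x = (\<lambda>j\<in>{1..r}. if j = i then H1_gen x else \<one>\<^bsub>H1\<^esub>)"

definition copy_c :: "nat \<Rightarrow> nat \<Rightarrow> heis_tuple" where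
  "copy_c r i = commutator (H1_power r) (copy_gen r i GenA) (copy_gen r i GenB)"

text \<open>Only the values \<open>D 1, \<dots>, D (r - 1)\<close> matter; they are the entries
  \<open>\<delta>\<^sub>1, \<dots>, \<delta>\<^sub>r\<^sub>-\<^sub>1\<close> of the tuple \<open>D\<close>. For \<open>r = 1\<close> the subgroup is trivial.\<close>

definition HD_subgroup :: "nat \<Rightarrow> (nat \<Rightarrow> nat) \<Rightarrow> heis_tuple set" where
  "HD_subgroup r D = generate (H1_power r)
    {copy_c r i \<otimes>\<^bsub>H1_power r\<^esub> (copy_c r 1 [^]\<^bsub>H1_power r\<^esub> (- int (D (i - 1)))) | i. i \<in> {2..r}}"

definition HD :: "nat \<Rightarrow> (nat \<Rightarrow> nat) \<Rightarrow> heis_tuple set monoid" where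
  "HD r D = H1_power r Mod HD_subgroup r D"

definition HD_gen :: "nat \<Rightarrow> (nat \<Rightarrow> nat) \<Rightarrow> nat \<Rightarrow> heis_gen \<Rightarrow> heis_tuple set" where
  "HD_gen r D i x = HD_subgroup r D #>\<^bsub>H1_power r\<^esub> copy_gen r i x"

definition admissible :: "nat \<Rightarrow> (nat \<Rightarrow> nat) \<Rightarrow> bool" where
  "admissible r D \<longleftrightarrow>
    (\<forall>i\<in>{1..<r}. D i \<ge> 1) \<and> (\<forall>i. 1 \<le> i \<and> i + 1 < r \<longrightarrow> D i dvd D (i + 1))"

definition NG :: "('g, 'm) monoid_scheme \<Rightarrow> nat \<Rightarrow> (nat \<Rightarrow> nat) \<Rightarrow> ('g \<times> heis_tuple set) monoid" where
  "NG \<Gamma> r D = \<Gamma> \<times>\<times> HD r D"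

definition torsion_free :: "('a, 'm) monoid_scheme \<Rightarrow> bool" where
  "torsion_free G \<longleftrightarrow> (\<forall>g\<in>carrier G. \<forall>n::nat. n > 0 \<and> g [^]\<^bsub>G\<^esub> n = \<one>\<^bsub>G\<^esub> \<longrightarrow> g = \<one>\<^bsub>G\<^esub>)"


section \<open>Rank and bases of abelian groups\<close>

definition finitely_generated :: "('a, 'm) monoid_scheme \<Rightarrow> bool" where
  "finitely_generated G \<longleftrightarrow> (\<exists>S. finite S \<and> S \<subseteq> carrier G \<and> generate G S = carrier G)"

text \<open>Linear independence over the integers of \<open>z 1, \<dots>, z m\<close>.\<close>

definition int_independent :: "('a, 'm) monoid_scheme \<Rightarrow> nat \<Rightarrow> (nat \<Rightarrow> 'a) \<Rightarrow> bool" where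
  "int_independent G m z \<longleftrightarrow> z ` {1..m} \<subseteq> carrier G \<and>
    (\<forall>l::nat \<Rightarrow> int. (\<Otimes>\<^bsub>G\<^esub>i\<in>{1..m}. z i [^]\<^bsub>G\<^esub> l i) = \<one>\<^bsub>G\<^esub> \<longrightarrow> (\<forall>i\<in>{1..m}. l i = 0))"

definition has_torsion_free_rank :: "('a, 'm) monoid_scheme \<Rightarrow> nat \<Rightarrow> bool" where
  "has_torsion_free_rank G s \<longleftrightarrow>
    (\<exists>z. int_independent G s z) \<and> \<not> (\<exists>z. int_independent G (Suc s) z)"

definition is_basis :: "('a, 'm) monoid_scheme \<Rightarrow> nat \<Rightarrow> (nat \<Rightarrow> 'a) \<Rightarrow> bool" where
  "is_basis G s z \<longleftrightarrow> int_independent G s z \<and> generate G (z ` {1..s}) = carrier G"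


section \<open>Normal forms, the abelianisation and the map \<open>\<theta>\<close>\<close>

text \<open>Coordinates are numbered from \<open>0\<close> to \<open>2 * r + s - 1\<close>, in the order
  \<open>z\<^sub>1, \<dots>, z\<^sub>s, a\<^sub>1, b\<^sub>1, \<dots>, a\<^sub>r, b\<^sub>r\<close>.\<close>

definition N_gen ::
  "('g, 'm) monoid_scheme \<Rightarrow> nat \<Rightarrow> (nat \<Rightarrow> 'g) \<Rightarrow> nat \<Rightarrow> (nat \<Rightarrow> nat) \<Rightarrow> nat \<Rightarrow> 'g \<times> heis_tuple set" where
  "N_gen \<Gamma> s z r D k =
    (if k < s then (z (k + 1), \<one>\<^bsub>HD r D\<^esub>)
     else (\<one>\<^bsub>\<Gamma>\<^esub>, HD_gen r D ((k - s) div 2 + 1) (if even (k - s) then GenA else GenB)))"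

text \<open>\<open>c = c\<^sub>1 = [a\<^sub>1, b\<^sub>1]\<close>.\<close>

definition N_c :: "('g, 'm) monoid_scheme \<Rightarrow> nat \<Rightarrow> (nat \<Rightarrow> nat) \<Rightarrow> 'g \<times> heis_tuple set" where
  "N_c \<Gamma> r D =
    commutator (NG \<Gamma> r D) (\<one>\<^bsub>\<Gamma>\<^esub>, HD_gen r D 1 GenA) (\<one>\<^bsub>\<Gamma>\<^esub>, HD_gen r D 1 GenB)"

text \<open>The ordered product \<open>g\<^sub>0\<^bsup>x\<^sub>0\<^esup> g\<^sub>1\<^bsup>x\<^sub>1\<^esup> \<cdots>\<close> in a group that need not be commutative.\<close>

definition power_prod :: "('a, 'm) monoid_scheme \<Rightarrow> (nat \<Rightarrow> 'a) \<Rightarrow> int vec \<Rightarrow> 'a" where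
  "power_prod G g x =
    foldr (\<lambda>u v. u \<otimes>\<^bsub>G\<^esub> v) (map (\<lambda>k. g k [^]\<^bsub>G\<^esub> (x $ k)) [0..<dim_vec x]) \<one>\<^bsub>G\<^esub>"

definition lift ::
  "('g, 'm) monoid_scheme \<Rightarrow> nat \<Rightarrow> (nat \<Rightarrow> 'g) \<Rightarrow> nat \<Rightarrow> (nat \<Rightarrow> nat) \<Rightarrow> int vec \<Rightarrow> 'g \<times> heis_tuple set" where
  "lift \<Gamma> s z r D x = power_prod (NG \<Gamma> r D) (N_gen \<Gamma> s z r D) x"

definition Ab :: "('a, 'm) monoid_scheme \<Rightarrow> 'a set monoid" where
  "Ab G = G Mod derived G (carrier G)"

definition ab_class :: "('a, 'm) monoid_scheme \<Rightarrow> 'a \<Rightarrow> 'a set" where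
  "ab_class G g = derived G (carrier G) #>\<^bsub>G\<^esub> g"

text \<open>The identification of \<open>Ab(N)\<close> with integer row vectors.\<close>

definition ab_coords ::
  "('g, 'm) monoid_scheme \<Rightarrow> nat \<Rightarrow> (nat \<Rightarrow> 'g) \<Rightarrow> nat \<Rightarrow> (nat \<Rightarrow> nat) \<Rightarrow> ('g \<times> heis_tuple set) set \<Rightarrow> int vec" where
  "ab_coords \<Gamma> s z r D C =
    (THE x. x \<in> carrier_vec (2 * r + s) \<and>
            C = power_prod (Ab (NG \<Gamma> r D)) (\<lambda>k. ab_class (NG \<Gamma> r D) (N_gen \<Gamma> s z r D k)) x)"

text \<open>The automorphism of \<open>Ab(N)\<close> induced by \<open>f\<close> sends a coset \<open>C\<close> to its image \<open>f ` C\<close>. Since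
  matrices act on row vectors from the right, the \<open>k\<close>-th row of \<open>\<theta>(f)\<close> holds the coordinates of
  the image of the \<open>k\<close>-th basis vector.\<close>

definition theta ::
  "('g, 'm) monoid_scheme \<Rightarrow> nat \<Rightarrow> (nat \<Rightarrow> 'g) \<Rightarrow> nat \<Rightarrow> (nat \<Rightarrow> nat) \<Rightarrow>
    ('g \<times> heis_tuple set \<Rightarrow> 'g \<times> heis_tuple set) \<Rightarrow> int mat" where
  "theta \<Gamma> s z r D f =
    mat_of_rows (2 * r + s)
      (map (\<lambda>k. ab_coords \<Gamma> s z r D (f ` ab_class (NG \<Gamma> r D) (N_gen \<Gamma> s z r D k))) [0..<2 * r + s])"

definition row_mult :: "'a :: comm_semiring_0 vec \<Rightarrow> 'a mat \<Rightarrow> 'a vec" where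
  "row_mult x M = vec (dim_col M) (\<lambda>j. x \<bullet> col M j)"


section \<open>Polynomial functions\<close>

text \<open>Real polynomial functions in \<open>n\<close> variables of total degree at most \<open>d\<close>; the sum ranges over the
  (finitely many) exponent vectors \<open>m\<close>.\<close>

definition poly_fun_deg_le :: "nat \<Rightarrow> nat \<Rightarrow> (real vec \<Rightarrow> real) \<Rightarrow> bool" where
  "poly_fun_deg_le n d \<gamma> \<longleftrightarrow>
    (\<exists>C :: (nat \<Rightarrow> nat) \<Rightarrow> real. \<forall>x\<in>carrier_vec n.
      \<gamma> x = (\<Sum>m\<in>{m. (\<forall>i\<ge>n. m i = 0) \<and> (\<Sum>i<n. m i) \<le> d}. C m * (\<Prod>i<n. (x $ i) ^ m i)))"

end

theory Submission
  imports Defs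
begin

text \<open>
  Let \<open>g\<^sub>0, \<dots>, g\<^sub>n\<^sub>-\<^sub>1\<close> be the basis elements of \<open>N\<close> in order and write \<open>g\<^sup>u\<close> for the ordered product of
  their powers. Commutators of basis elements are powers of the central element \<open>c\<close>, so
  \<open>g\<^sup>u g\<^sup>v = g\<^sup>u\<^sup>+\<^sup>v c\<^bsup>\<beta>(u,v)\<^esup>\<close> for a bilinear form \<open>\<beta>\<close>, and hence the \<open>k\<close>-th power of \<open>g\<^sup>u\<close> is
  \<open>g\<^bsup>ku\<^esup> c\<^bsup>\<beta>(u,u) k(k-1)/2\<^esup>\<close>. If \<open>f\<close> maps \<open>g\<^sub>k\<close> to \<open>g\<^bsup>M k\<^esup> c\<^bsup>t k\<^esup>\<close>, collecting the powers of \<open>c\<close> in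
  the product of the \<open>f(g\<^sub>k)\<^bsup>x k\<^esup>\<close> gives \<open>\<gamma>(x)\<close> as an explicit quadratic polynomial.

  The sign \<open>\<epsilon>\<close> exists because \<open>f\<close> permutes the derived subgroup \<open>\<langle>c\<rangle>\<close>, and \<open>c\<close> is either trivial or of
  infinite order since \<open>N\<close> is torsion-free. That the coordinates of \<open>Ab(N)\<close> are well defined follows
  from the projection to \<open>\<Gamma>\<close> and from the exponent sums of the generators of the copies of \<open>H\<^sub>1\<close>.
\<close>


section \<open>Ordered products in groups of class two\<close>

text \<open>Conjugation carries a commutation relation over to all integer powers at once, because
  homomorphisms respect \<open>[^]\<close>; signed exponents then call for no induction.\<close>

lemma (in group) conjugation_hom:
  assumes "x \<in> carrier G"
  shows "(\<lambda>h. x \<otimes> h \<otimes> inv x) \<in> hom G G"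
proof (rule homI)
  fix a b assume "a \<in> carrier G" "b \<in> carrier G"
  moreover from this have "inv x \<otimes> (x \<otimes> (b \<otimes> inv x)) = b \<otimes> inv x"
    using assms by (subst m_assoc[symmetric]) auto
  ultimately show "x \<otimes> (a \<otimes> b) \<otimes> inv x = x \<otimes> a \<otimes> inv x \<otimes> (x \<otimes> b \<otimes> inv x)"
    using assms by (simp add: m_assoc)
qed (use assms in auto)

lemma (in group) int_pow_commute:
  fixes k :: int
  assumes "x \<in> carrier G" "y \<in> carrier G" "x \<otimes> y = y \<otimes> x"
  shows "x \<otimes> y [^] k = y [^] k \<otimes> x"
proof -
  interpret group_hom G G "\<lambda>h. x \<otimes> h \<otimes> inv x"
    by unfold_locales (rule conjugation_hom, fact)
  have "x \<otimes> y \<otimes> inv x = y"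
    by (subst assms(3)) (simp add: assms(1,2) m_assoc)
  hence "x \<otimes> y [^] k \<otimes> inv x = y [^] k"
    using assms(1,2) hom_int_pow[of y k] by simp
  thus ?thesis
    using assms(1,2) inv_solve_right'[of "y [^] k" "x \<otimes> y [^] k" x] by simp
qed

text \<open>Conjugation by \<open>x\<close> sends \<open>y\<close> to \<open>y \<otimes> d\<close>.
  As \<open>y\<close> and \<open>d\<close> commute, powers of this product split, and
  \<open>d [^] k\<close> can finally be moved past \<open>x\<close>.\<close>

lemma (in group) int_pow_swap_right:
  fixes k :: int
  assumes "x \<in> carrier G" "y \<in> carrier G" "d \<in> carrier G"
    and "y \<otimes> d = d \<otimes> y" and "x \<otimes> y = y \<otimes> x \<otimes> d" "x \<otimes> d = d \<otimes> x"
  shows "x \<otimes> y [^] k = y [^] k \<otimes> x \<otimes> d [^] k"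
proof -
  interpret group_hom G G "\<lambda>h. x \<otimes> h \<otimes> inv x"
    by unfold_locales (rule conjugation_hom, fact)
  have "x \<otimes> y \<otimes> inv x = y \<otimes> d"
    unfolding assms(5) m_assoc[OF assms(2,1,3)] assms(6) by (simp add: assms(1-3) m_assoc)
  hence "x \<otimes> y [^] k \<otimes> inv x = y [^] k \<otimes> d [^] k"
    using assms(1-3) hom_int_pow[of y k] int_pow_mult_distrib[OF assms(4,2,3)] by simp
  hence "x \<otimes> y [^] k = y [^] k \<otimes> d [^] k \<otimes> x"
    using assms(1-3) inv_solve_right'[of "y [^] k \<otimes> d [^] k" "x \<otimes> y [^] k" x] by simp
  thus ?thesis
    using assms(1-3) int_pow_commute[OF assms(1,3,6), of k] by (simp add: m_assoc)
qed

text \<open>The assumptions are the rules for collecting words; independence of the generators comes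
  in \<open>free_class2_basis\<close>. The exponents \<open>w j i\<close> are a choice, unique only
  when \<open>c\<close> has infinite order.\<close>

locale class2_basis = group G for G (structure) +
  fixes g :: "nat \<Rightarrow> 'a" and c :: 'a and n :: nat and w :: "nat \<Rightarrow> nat \<Rightarrow> int"
  assumes gen_closed [simp]: "i < n \<Longrightarrow> g i \<in> carrier G"
    and c_closed [simp]: "c \<in> carrier G"
    and c_central: "x \<in> carrier G \<Longrightarrow> x \<otimes> c = c \<otimes> x"
    and gen_swap: "\<lbrakk>i < n; j < n\<rbrakk> \<Longrightarrow> g j \<otimes> g i = g i \<otimes> g j \<otimes> c [^] w j i"
    and generated: "generate G (g ` {..<n}) = carrier G"
begin

lemma cpow_commute: "x \<in> carrier G \<Longrightarrow> c [^] (k::int) \<otimes> x = x \<otimes> c [^] k"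
  using int_pow_commute[of x c k] c_central by simp

lemma mult_cpow:
  assumes "x \<in> carrier G" "y \<in> carrier G"
  shows "(x \<otimes> c [^] (k::int)) \<otimes> (y \<otimes> c [^] (l::int)) = x \<otimes> y \<otimes> c [^] (k + l)"
proof -
  have "(x \<otimes> c [^] k) \<otimes> (y \<otimes> c [^] l) = x \<otimes> (c [^] k \<otimes> y) \<otimes> c [^] l"
    using assms by (simp add: m_assoc)
  also have "\<dots> = x \<otimes> y \<otimes> (c [^] k \<otimes> c [^] l)"
    unfolding cpow_commute[OF assms(2)] using assms by (simp add: m_assoc)
  finally show ?thesis
    by (simp add: int_pow_mult)
qed

lemma pow_cpow:
  "x \<in> carrier G \<Longrightarrow> (x \<otimes> c [^] (k::int)) [^] (l::int) = x [^] l \<otimes> c [^] (k * l)"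
  by (simp add: int_pow_mult_distrib cpow_commute int_pow_pow)

text \<open>The two exponents enter one at a time: \<open>swap\<close> raises the right factor to a
  power, \<open>flip\<close> exchanges the roles of the factors with the opposite sign, and a second
  \<open>swap\<close> treats the other factor.\<close>

lemma swap_pow:
  assumes x: "x \<in> carrier G" and y: "y \<in> carrier G" and xy: "x \<otimes> y = y \<otimes> x \<otimes> c [^] (k::int)"
  shows "x [^] (a::int) \<otimes> y [^] (b::int) = y [^] b \<otimes> x [^] a \<otimes> c [^] (k * a * b)"
proof -
  have swap: "u \<otimes> v [^] (m::int) = v [^] m \<otimes> u \<otimes> c [^] (l * m)"
    if "u \<in> carrier G" "v \<in> carrier G" "u \<otimes> v = v \<otimes> u \<otimes> c [^] (l::int)" for u v l m
    using that int_pow_swap_right[of u v "c [^] l" m] by (simp add: cpow_commute int_pow_pow)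
  have flip: "v \<otimes> u = u \<otimes> v \<otimes> c [^] (- l)"
    if "u \<in> carrier G" "v \<in> carrier G" "u \<otimes> v = v \<otimes> u \<otimes> c [^] (l::int)" for u v l
    using that by (simp add: m_assoc flip: int_pow_mult)
  have "x \<otimes> y [^] b = y [^] b \<otimes> x \<otimes> c [^] (k * b)"
    using swap[OF x y xy] .
  from flip[OF x _ this] have "y [^] b \<otimes> x = x \<otimes> y [^] b \<otimes> c [^] (- (k * b))"
    using y by simp
  from swap[OF _ x this, of a] have "y [^] b \<otimes> x [^] a = x [^] a \<otimes> y [^] b \<otimes> c [^] (- (k * b) * a)"
    using y by simp
  from flip[OF _ _ this] show ?thesis
    using x y by (simp add: mult_ac)
qed

section \<open>Collecting products of ordered words\<close>

fun normal_word :: "nat \<Rightarrow> (nat \<Rightarrow> int) \<Rightarrow> 'a" where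
  "normal_word 0 u = \<one>"
| "normal_word (Suc m) u = normal_word m u \<otimes> g m [^] u m"

text \<open>The power of \<open>c\<close> released when two ordered words are merged:
  \<open>g j [^] u j\<close> of the left word must pass \<open>g i [^] v i\<close> of the right word
  exactly when \<open>i < j\<close>.\<close>

definition \<beta> :: "nat \<Rightarrow> (nat \<Rightarrow> int) \<Rightarrow> (nat \<Rightarrow> int) \<Rightarrow> int" where
  "\<beta> m u v = (\<Sum>j<m. \<Sum>i<j. w j i * u j * v i)"

lemma normal_word_closed [simp]: "m \<le> n \<Longrightarrow> normal_word m u \<in> carrier G"
  by (induction m) auto

lemma normal_word_cong: "(\<And>i. i < m \<Longrightarrow> u i = v i) \<Longrightarrow> normal_word m u = normal_word m v"
  by (induction m) auto

lemma normal_word_zero [simp]: "normal_word m (\<lambda>_. 0) = \<one>"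
  by (induction m) auto

lemma gen_pow_normal_word:
  assumes "m \<le> n" "j < n"
  shows "g j [^] (a::int) \<otimes> normal_word m u = normal_word m u \<otimes> g j [^] a \<otimes> c [^] (\<Sum>i<m. w j i * a * u i)"
  using assms
proof (induction m)
  case (Suc m)
  let ?s = "\<Sum>i<m. w j i * a * u i"
  have "g j [^] a \<otimes> normal_word (Suc m) u = (g j [^] a \<otimes> normal_word m u) \<otimes> g m [^] u m"
    using Suc.prems by (simp add: m_assoc)
  also have "\<dots> = normal_word m u \<otimes> g j [^] a \<otimes> (c [^] ?s \<otimes> g m [^] u m)"
    using Suc by (simp add: m_assoc)
  also have "\<dots> = normal_word m u \<otimes> (g j [^] a \<otimes> g m [^] u m) \<otimes> c [^] ?s"
    using Suc.prems by (simp add: m_assoc cpow_commute)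
  also have "\<dots> = normal_word m u \<otimes> (g m [^] u m \<otimes> g j [^] a \<otimes> c [^] (w j m * a * u m)) \<otimes> c [^] ?s"
    by (subst swap_pow[OF _ _ gen_swap[of m j]]) (use Suc.prems in auto)
  finally show ?case
    using Suc.prems by (simp add: m_assoc int_pow_mult add.commute)
qed simp

text \<open>With the last generator split off, the only new crossing is \<open>g m [^] u m\<close>
  over \<open>normal_word m v\<close>; it releases precisely the summand \<open>j = m\<close> of
  \<open>\<beta>\<close>.\<close>

lemma normal_word_mult:
  assumes "m \<le> n"
  shows "normal_word m u \<otimes> normal_word m v = normal_word m (\<lambda>i. u i + v i) \<otimes> c [^] \<beta> m u v"
  using assms
proof (induction m)
  case (Suc m)
  let ?s = "\<Sum>i<m. w m i * u m * v i"
  have "normal_word (Suc m) u \<otimes> normal_word (Suc m) v = normal_word m u \<otimes> (g m [^] u m \<otimes> normal_word m v) \<otimes> g m [^] v m"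
    using Suc.prems by (simp add: m_assoc)
  also have "\<dots> = normal_word m u \<otimes> normal_word m v \<otimes> g m [^] u m \<otimes> (c [^] ?s \<otimes> g m [^] v m)"
    using Suc.prems by (simp add: gen_pow_normal_word m_assoc)
  also have "\<dots> = (normal_word m u \<otimes> normal_word m v) \<otimes> (g m [^] u m \<otimes> g m [^] v m \<otimes> c [^] ?s)"
    using Suc.prems by (simp add: cpow_commute m_assoc)
  also have "\<dots> = (normal_word m (\<lambda>i. u i + v i) \<otimes> c [^] \<beta> m u v) \<otimes> (g m [^] (u m + v m) \<otimes> c [^] ?s)"
    using Suc by (simp add: int_pow_mult)
  also have "\<dots> = normal_word (Suc m) (\<lambda>i. u i + v i) \<otimes> c [^] (\<beta> m u v + ?s)"
    using Suc.prems by (subst mult_cpow) auto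
  finally show ?case
    by (simp add: \<beta>_def)
qed (simp add: \<beta>_def)

lemma normal_form_mult:
  "(normal_word n u \<otimes> c [^] (k::int)) \<otimes> (normal_word n v \<otimes> c [^] (l::int))
    = normal_word n (\<lambda>i. u i + v i) \<otimes> c [^] (\<beta> n u v + (k + l))"
  by (simp add: mult_cpow normal_word_mult) (simp add: m_assoc flip: int_pow_mult)

lemma \<beta>_scale_left: "\<beta> m (\<lambda>i. k * u i) v = k * \<beta> m u v"
  and \<beta>_scale_right: "\<beta> m u (\<lambda>i. k * v i) = k * \<beta> m u v"
  by (simp_all add: \<beta>_def sum_distrib_left mult_ac)

lemma \<beta>_sum_left: "\<beta> m (\<lambda>i. \<Sum>a\<in>A. U a i) v = (\<Sum>a\<in>A. \<beta> m (U a) v)"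
proof -
  have "\<beta> m (\<lambda>i. \<Sum>a\<in>A. U a i) v = (\<Sum>j<m. \<Sum>i<j. \<Sum>a\<in>A. w j i * U a j * v i)"
    by (simp add: \<beta>_def sum_distrib_left sum_distrib_right)
  also have "\<dots> = (\<Sum>j<m. \<Sum>a\<in>A. \<Sum>i<j. w j i * U a j * v i)"
    by (rule sum.cong[OF HOL.refl], rule sum.swap)
  also have "\<dots> = (\<Sum>a\<in>A. \<beta> m (U a) v)"
    unfolding \<beta>_def by (rule sum.swap)
  finally show ?thesis .
qed

text \<open>One more factor costs k times \<open>\<beta> n u u\<close>, and these costs add up to
  the triangular number. The identity \<open>step\<close> holds for every integer, so after
  cancellation at \<open>k - 1\<close> it serves the negative exponents too.\<close>

lemma normal_word_pow:
  "normal_word n u [^] (k::int) = normal_word n (\<lambda>i. k * u i) \<otimes> c [^] (\<beta> n u u * (k * (k - 1) div 2))"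
proof -
  have step: "normal_word n (\<lambda>i. k * u i) \<otimes> c [^] (\<beta> n u u * (k * (k - 1) div 2)) \<otimes> normal_word n u =
    normal_word n (\<lambda>i. (k + 1) * u i) \<otimes> c [^] (\<beta> n u u * ((k + 1) * k div 2))" for k
  proof -
    have "(k + 1) * k = k * (k - 1) + k * 2"
      by (simp add: algebra_simps)
    hence T: "(k + 1) * k div 2 = k * (k - 1) div 2 + k"
      by simp
    have "normal_word n (\<lambda>i. k * u i) \<otimes> c [^] (\<beta> n u u * (k * (k - 1) div 2)) \<otimes> normal_word n u
        = normal_word n (\<lambda>i. k * u i) \<otimes> normal_word n u \<otimes> c [^] (\<beta> n u u * (k * (k - 1) div 2))"
      by (simp add: cpow_commute m_assoc)
    thus ?thesis
      by (simp add: normal_word_mult \<beta>_scale_left T m_assoc flip: int_pow_mult)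
         (simp add: algebra_simps)
  qed
  show ?thesis
  proof (induction k rule: int_induct[where k = 0])
    case base
    show ?case by simp
  next
    case (step1 k)
    have "normal_word n u [^] (k + 1) = normal_word n u [^] k \<otimes> normal_word n u"
      by (simp add: int_pow_mult)
    with step1 step[of k] show ?case
      by simp
  next
    case (step2 k)
    have "normal_word n u [^] (k - 1) \<otimes> normal_word n u = normal_word n u [^] k"
      using int_pow_mult[of "normal_word n u" "k - 1" 1] by simp
    also have "\<dots> = normal_word n (\<lambda>i. (k - 1) * u i) \<otimes> c [^] (\<beta> n u u * ((k - 1) * (k - 1 - 1) div 2)) \<otimes> normal_word n u"
      using step2 step[of "k - 1"] by simp
    finally show ?case
      by (subst (asm) right_cancel) auto
  qed
qed

text \<open>The three kinds of summands have separate sources: the central part of each image, the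
  powers of a single image by \<open>normal_word_pow\<close>, and the merging of different images.
  Only the number of factors is bounded by \<open>m\<close>, which allows induction; the form
  \<open>\<beta> n\<close> always uses all coordinates.\<close>

definition \<gamma> :: "(nat \<Rightarrow> nat \<Rightarrow> int) \<Rightarrow> (nat \<Rightarrow> int) \<Rightarrow> nat \<Rightarrow> (nat \<Rightarrow> int) \<Rightarrow> int" where
  "\<gamma> A t m x = (\<Sum>k<m. t k * x k + \<beta> n (A k) (A k) * (x k * (x k - 1) div 2)
                  + (\<Sum>i<k. \<beta> n (A i) (A k) * x i * x k))"

lemma hom_normal_word:
  assumes "h \<in> hom G G" and h: "\<And>k. k < n \<Longrightarrow> h (g k) = normal_word n (A k) \<otimes> c [^] t k" and "m \<le> n"
  shows "h (normal_word m x) = normal_word n (\<lambda>i. \<Sum>k<m. x k * A k i) \<otimes> c [^] \<gamma> A t m x"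
proof -
  interpret h: group_hom G G h
    by unfold_locales fact
  from \<open>m \<le> n\<close> show ?thesis
  proof (induction m)
    case 0
    show ?case by (simp add: \<gamma>_def)
  next
    case (Suc m)
    let ?T = "x m * (x m - 1) div 2"
    let ?U = "\<lambda>i. \<Sum>k<m. x k * A k i"
    \<comment> \<open>Merging the next image with those already collected costs this value;
      bilinearity turns it into the mixed terms of \<open>\<gamma>\<close>.\<close>
    have \<beta>: "\<beta> n ?U (\<lambda>i. x m * A m i) = (\<Sum>k<m. \<beta> n (A k) (A m) * x k * x m)"
      by (simp add: \<beta>_sum_left \<beta>_scale_left \<beta>_scale_right mult_ac)
    have "h (g m [^] x m) = (normal_word n (A m) \<otimes> c [^] t m) [^] x m"
      using Suc.prems by (simp add: h.hom_int_pow h)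
    also have "\<dots> = normal_word n (\<lambda>i. x m * A m i) \<otimes> c [^] (\<beta> n (A m) (A m) * ?T + t m * x m)"
      by (simp add: pow_cpow normal_word_pow m_assoc int_pow_mult)
    finally have "h (normal_word (Suc m) x) =
        normal_word n ?U \<otimes> normal_word n (\<lambda>i. x m * A m i) \<otimes> c [^] (\<gamma> A t m x + (\<beta> n (A m) (A m) * ?T + t m * x m))"
      using Suc by (simp add: mult_cpow)
    also have "\<dots> = normal_word n (\<lambda>i. \<Sum>k<Suc m. x k * A k i) \<otimes> c [^] \<gamma> A t (Suc m) x"
      by (simp add: normal_word_mult \<beta> m_assoc flip: int_pow_mult) (simp add: \<gamma>_def algebra_simps)
    finally show ?case .
  qed
qed

section \<open>Normal forms, the derived subgroup and the sign\<close>

lemma subgroup_normal_forms: "subgroup {normal_word n u \<otimes> c [^] (k::int) | u k. True} G" (is "subgroup ?K G")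
proof (rule subgroupI)
  show "?K \<subseteq> carrier G" "?K \<noteq> {}"
    by auto
  show "x \<otimes> y \<in> ?K" if "x \<in> ?K" "y \<in> ?K" for x y
  proof -
    from that obtain u v k l where "x = normal_word n u \<otimes> c [^] (k::int)" "y = normal_word n v \<otimes> c [^] (l::int)"
      by blast
    hence "x \<otimes> y = normal_word n (\<lambda>i. u i + v i) \<otimes> c [^] (\<beta> n u v + (k + l))"
      by (simp only: normal_form_mult)
    thus ?thesis by blast
  qed
  show "inv x \<in> ?K" if "x \<in> ?K" for x
  proof -
    from that obtain u k where x: "x = normal_word n u \<otimes> c [^] (k::int)"
      by blast
    \<comment> \<open>Negating the exponents inverts the word only up to a power of
      \<open>c\<close>; the central exponent is chosen to cancel that power.\<close>
    define y where "y = normal_word n (\<lambda>i. - u i) \<otimes> c [^] (- k - \<beta> n (\<lambda>i. - u i) u)"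
    have "y \<otimes> x = normal_word n (\<lambda>i. - u i) \<otimes> normal_word n u \<otimes> c [^] (- \<beta> n (\<lambda>i. - u i) u)"
      unfolding x y_def by (subst mult_cpow) auto
    also have "\<dots> = \<one>"
      by (simp add: normal_word_mult m_assoc flip: int_pow_mult)
    finally have "inv x = y"
      by (intro inv_equality) (auto simp: x y_def)
    thus ?thesis
      unfolding y_def by blast
  qed
qed

lemma normal_word_unit: "k < m \<Longrightarrow> m \<le> n \<Longrightarrow> normal_word m (\<lambda>i. if i = k then 1 else 0) = g k"
proof (induction m)
  case (Suc m)
  have "normal_word m (\<lambda>i. if i = m then 1 else 0) = normal_word m (\<lambda>_. 0)"
    by (rule normal_word_cong) auto
  with Suc show ?case
    by (cases "k = m") auto
qed simp

lemma normal_form: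
  assumes "x \<in> carrier G"
  obtains u k where "x = normal_word n u \<otimes> c [^] (k::int)"
proof -
  have "g k \<in> {normal_word n u \<otimes> c [^] (k::int) | u k. True}" if "k < n" for k
    using normal_word_unit[OF that] that
    by (intro CollectI exI[of _ "\<lambda>i. if i = k then 1 else 0"] exI[of _ 0]) auto
  hence "generate G (g ` {..<n}) \<subseteq> {normal_word n u \<otimes> c [^] (k::int) | u k. True}"
    by (intro generate_subgroup_incl subgroup_normal_forms) blast
  with assms that show thesis
    unfolding generated by blast
qed

lemma derived_subset: "derived G (carrier G) \<subseteq> range (\<lambda>k::int. c [^] k)"
proof -
  have "subgroup (range (\<lambda>k::int. c [^] k)) G"
    by (intro subgroupI) (auto simp: int_pow_mult[symmetric] int_pow_neg[symmetric])
  moreover have "x \<otimes> y \<otimes> inv x \<otimes> inv y \<in> range (\<lambda>k::int. c [^] k)"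
    if "x \<in> carrier G" "y \<in> carrier G" for x y
  proof -
    from that obtain u v k l where xy: "x = normal_word n u \<otimes> c [^] (k::int)" "y = normal_word n v \<otimes> c [^] (l::int)"
      by (metis normal_form)
    \<comment> \<open>Both orders of multiplication give the same exponent vector, so the two
      products differ by a power of \<open>c\<close> alone.\<close>
    have "x \<otimes> y = normal_word n (\<lambda>i. u i + v i) \<otimes> c [^] (\<beta> n u v + (k + l))"
      unfolding xy by (rule normal_form_mult)
    moreover have "y \<otimes> x = normal_word n (\<lambda>i. u i + v i) \<otimes> c [^] (\<beta> n v u + (k + l))"
      unfolding xy normal_form_mult by (simp add: add_ac)
    ultimately have "x \<otimes> y = c [^] (\<beta> n u v - \<beta> n v u) \<otimes> (y \<otimes> x)"
      by (simp add: cpow_commute m_assoc flip: int_pow_mult) (simp add: add_ac)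
    hence "x \<otimes> y \<otimes> inv x \<otimes> inv y = c [^] (\<beta> n u v - \<beta> n v u)"
      using that by (simp add: m_assoc)
    thus ?thesis by blast
  qed
  ultimately show ?thesis
    unfolding derived_def by (intro generate_subgroup_incl) auto
qed

text \<open>\<open>power_prod\<close> is folded from the right while \<open>normal_word\<close>
  grows at its right end, so the last factor is first pulled out of the fold by
  reassociation.\<close>

lemma power_prod_eq_normal_word: "power_prod G g x = normal_word (dim_vec x) (\<lambda>i. x $ i)" if "dim_vec x \<le> n"
proof -
  have foldr: "foldr (\<otimes>) xs a = foldr (\<otimes>) xs \<one> \<otimes> a" if "set xs \<subseteq> carrier G" "a \<in> carrier G" for xs a
  proof -
    have "foldr (\<otimes>) ys \<one> \<in> carrier G" if "set ys \<subseteq> carrier G" for ys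
      using that by (induction ys) auto
    with that show ?thesis
      by (induction xs) (auto simp: m_assoc)
  qed
  have "foldr (\<otimes>) (map (\<lambda>k. g k [^] u k) [0..<m]) \<one> = normal_word m u" if "m \<le> n" for m and u :: "nat \<Rightarrow> int"
    using that
  proof (induction m)
    case (Suc m)
    have "foldr (\<otimes>) (map (\<lambda>k. g k [^] u k) [0..<Suc m]) \<one>
        = foldr (\<otimes>) (map (\<lambda>k. g k [^] u k) [0..<m]) \<one> \<otimes> g m [^] u m"
      using Suc.prems by (simp, subst foldr) auto
    with Suc show ?case by simp
  qed simp
  thus ?thesis
    using that by (simp add: power_prod_def)
qed

lemma derived_eq:
  assumes "c \<in> derived G (carrier G)"
  shows "derived G (carrier G) = range (\<lambda>k::int. c [^] k)"
  using derived_subset assms subgroup_int_pow_closed[OF derived_is_subgroup] by blast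

lemma automorphism_central:
  assumes f: "f \<in> auto G" and tf: "torsion_free G" and c: "c \<in> derived G (carrier G)"
  obtains \<epsilon> :: int where "\<epsilon> \<in> {1, -1}" "f c = c [^] \<epsilon>"
proof -
  have "f \<in> hom G G" and bij: "bij_betw f (carrier G) (carrier G)"
    using f by (auto simp: auto_def Bij_def)
  then interpret f: group_hom G G f
    by unfold_locales
  have img: "f ` derived G (carrier G) = derived G (carrier G)"
    using f.derived_img[of "carrier G"] bij by (simp add: bij_betw_def)
  obtain e where e: "f c = c [^] (e::int)"
    using c img derived_eq[OF c] by blast
  \<comment> \<open>As \<open>f\<close> is onto the derived subgroup, \<open>c\<close> has a
    preimage \<open>c [^] k\<close>; together with \<open>f c = c [^] e\<close> this shows that
    \<open>e * k - 1\<close> annihilates \<open>c\<close>.\<close>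
  have "c \<in> f ` range (\<lambda>k::int. c [^] k)"
    using c img derived_eq[OF c] by simp
  then obtain k where k: "c = f (c [^] (k::int))"
    by (metis (no_types, lifting) imageE)
  hence "c [^] (e * k) = c"
    using e by (simp add: f.hom_int_pow int_pow_pow)
  hence one: "c [^] (e * k - 1) = \<one>"
    using int_pow_diff[of c "e * k" 1] by simp
  show thesis
  proof (cases "e * k = 1")
    case True
    with e that show thesis
      by (auto simp: zmult_eq_1_iff)
  next
    case False
    \<comment> \<open>The nonzero exponent may be negative, whereas \<open>torsion_free\<close>
      refers to natural powers. Once \<open>c\<close> is trivial either sign would do, and 1 is
      taken.\<close>
    have "c [^] nat \<bar>e * k - 1\<bar> = \<one>"
      using one int_pow_neg[of c "e * k - 1"]
      by (auto simp: abs_if simp flip: int_pow_int)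
    with False tf have "c = \<one>"
      unfolding torsion_free_def by (metis c_closed abs_ge_zero diff_eq_eq eq_iff_diff_eq_0 not_gr0 nat_0_iff abs_le_zero_iff)
    with e that[of 1] show thesis
      by simp
  qed
qed

end

lemma (in group_hom) hom_power_prod:
  assumes "\<And>k. k < dim_vec x \<Longrightarrow> g k \<in> carrier G"
  shows "h (power_prod G g x) = power_prod H (\<lambda>k. h (g k)) x"
proof -
  \<comment> \<open>Closure of the partial products is carried through the induction because
    \<open>h\<close> is multiplicative only on the carrier.\<close>
  have "h (foldr (\<otimes>) (map (\<lambda>k. g k [^] (x $ k)) ks) \<one>)
      = foldr (\<otimes>\<^bsub>H\<^esub>) (map (\<lambda>k. h (g k) [^]\<^bsub>H\<^esub> (x $ k)) ks) \<one>\<^bsub>H\<^esub>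
      \<and> foldr (\<otimes>) (map (\<lambda>k. g k [^] (x $ k)) ks) \<one> \<in> carrier G"
    if "set ks \<subseteq> set [0..<dim_vec x]" for ks
    using that assms by (induction ks) (auto simp: hom_int_pow)
  from this[OF order_refl] show ?thesis
    by (simp add: power_prod_def)
qed

text \<open>Independence is required modulo the powers of \<open>c\<close>, which is what unique
  coordinates on \<open>Ab\<close> amount to; \<open>c_derived\<close> makes these powers the whole
  derived subgroup. The order of \<open>c\<close> stays open.\<close>

locale free_class2_basis = class2_basis +
  assumes independent: "\<lbrakk>normal_word n u = c [^] (k::int); i < n\<rbrakk> \<Longrightarrow> u i = 0"
    and c_derived: "c \<in> derived G (carrier G)"
begin

section \<open>Coordinates on the abelianisation\<close>

lemma ab_class_hom: "ab_class G \<in> hom G (Ab G)"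
  unfolding ab_class_def Ab_def using normal.r_coset_hom_Mod[OF derived_self_is_normal] .

lemma group_hom_ab_class: "group_hom G (Ab G) (ab_class G)"
proof -
  have "group (Ab G)"
    using derived_quot_is_group by (simp only: Ab_def)
  thus ?thesis
    by (simp only: group_hom_def group_hom_axioms_def ab_class_hom is_group)
qed

lemma ab_class_eqD:
  assumes "ab_class G (normal_word n u \<otimes> c [^] (k::int)) = ab_class G (normal_word n v \<otimes> c [^] (l::int))" "i < n"
  shows "u i = v i"
proof -
  have "normal_word n u \<otimes> c [^] k \<in> derived G (carrier G) #> (normal_word n v \<otimes> c [^] l)"
    using rcos_self[OF _ derived_is_subgroup, of "normal_word n u \<otimes> c [^] k" "carrier G"] assms(1)
    unfolding ab_class_def by simp
  then obtain m :: int where "normal_word n u \<otimes> c [^] k = c [^] m \<otimes> (normal_word n v \<otimes> c [^] l)"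
    using derived_eq[OF c_derived] by (auto simp: r_coset_def)
  also have "\<dots> = normal_word n v \<otimes> c [^] (m + l)"
    by (simp add: cpow_commute[of "normal_word n v \<otimes> c [^] l"] m_assoc add.commute flip: int_pow_mult)
  \<comment> \<open>Left multiplication by the word of \<open>- v\<close> clears \<open>v\<close> up
    to a power of \<open>c\<close>. The word of the difference of \<open>u\<close> and
    \<open>v\<close> thus becomes a power of \<open>c\<close>, and independence applies.\<close>
  finally have "(normal_word n (\<lambda>i. - v i) \<otimes> c [^] (0::int)) \<otimes> (normal_word n u \<otimes> c [^] k)
      = (normal_word n (\<lambda>i. - v i) \<otimes> c [^] (0::int)) \<otimes> (normal_word n v \<otimes> c [^] (m + l))"
    by simp
  hence eq: "normal_word n (\<lambda>i. - v i + u i) \<otimes> c [^] (\<beta> n (\<lambda>i. - v i) u + k)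
      = c [^] (\<beta> n (\<lambda>i. - v i) v + (m + l))"
    unfolding normal_form_mult by simp
  have "normal_word n (\<lambda>i. - v i + u i) = normal_word n (\<lambda>i. - v i + u i) \<otimes> c [^] (\<beta> n (\<lambda>i. - v i) u + k)
      \<otimes> c [^] (- (\<beta> n (\<lambda>i. - v i) u + k))"
    by (simp only: m_assoc normal_word_closed int_pow_closed c_closed order_refl flip: int_pow_mult) simp
  also have "\<dots> = c [^] (\<beta> n (\<lambda>i. - v i) v + (m + l) - (\<beta> n (\<lambda>i. - v i) u + k))"
    unfolding eq by (simp only: c_closed diff_conv_add_uminus flip: int_pow_mult)
  finally show ?thesis
    using independent[OF _ \<open>i < n\<close>] by fastforce
qed

lemma power_prod_ab_class:
  assumes "x \<in> carrier_vec n"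
  shows "power_prod (Ab G) (\<lambda>k. ab_class G (g k)) x = ab_class G (normal_word n (\<lambda>i. x $ i))"
  using group_hom.hom_power_prod[OF group_hom_ab_class, of x g] power_prod_eq_normal_word[of x] assms
  by simp

lemma ab_class_cpow:
  assumes "x \<in> carrier G"
  shows "ab_class G (x \<otimes> c [^] (k::int)) = ab_class G x"
proof -
  have D: "subgroup (derived G (carrier G)) G"
    by (simp add: derived_is_subgroup)
  have "c [^] k \<otimes> x \<in> derived G (carrier G) #> x"
    using derived_eq[OF c_derived] by (auto simp: r_coset_def)
  thus ?thesis
    unfolding ab_class_def using repr_independence[OF _ _ D, of _ x] assms cpow_commute by simp
qed

text \<open>Justifies the definite description in \<open>ab_coords\<close>: existence comes from
  \<open>normal_form\<close> once the power of \<open>c\<close> is absorbed, uniqueness from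
  \<open>ab_class_eqD\<close>.\<close>

lemma coordinates_eq:
  assumes "x \<in> carrier G"
  shows "\<exists>!u. u \<in> carrier_vec n \<and> ab_class G x = power_prod (Ab G) (\<lambda>k. ab_class G (g k)) u"
proof -
  obtain u k where x: "x = normal_word n u \<otimes> c [^] (k::int)"
    using normal_form[OF assms] .
  have normal_word: "normal_word n (\<lambda>i. vec n u $ i) = normal_word n u"
    by (rule normal_word_cong) simp
  show ?thesis
  proof (rule ex1I[of _ "vec n u"])
    show "vec n u \<in> carrier_vec n \<and> ab_class G x = power_prod (Ab G) (\<lambda>k. ab_class G (g k)) (vec n u)"
      using power_prod_ab_class[of "vec n u"] by (simp add: x ab_class_cpow normal_word)
  next
    fix v assume v: "v \<in> carrier_vec n \<and> ab_class G x = power_prod (Ab G) (\<lambda>k. ab_class G (g k)) v"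
    hence "ab_class G (normal_word n u \<otimes> c [^] k) = ab_class G (normal_word n (\<lambda>i. v $ i) \<otimes> c [^] (0::int))"
      by (simp add: power_prod_ab_class x)
    hence "u i = v $ i" if "i < n" for i
      using ab_class_eqD that by blast
    with v show "v = vec n u"
      by auto
  qed
qed

text \<open>Since \<open>f\<close> permutes the derived subgroup, it maps cosets onto cosets; thus
  the rows of \<open>theta\<close> are the coordinates of the images of the generators.\<close>

lemma ab_class_image:
  assumes f: "f \<in> auto G" and x: "x \<in> carrier G"
  shows "f ` ab_class G x = ab_class G (f x)"
proof -
  have "f \<in> hom G G" and bij: "bij_betw f (carrier G) (carrier G)"
    using f by (auto simp: auto_def Bij_def)
  then interpret f: group_hom G G f
    by unfold_locales
  have img: "f ` derived G (carrier G) = derived G (carrier G)"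
    using f.derived_img[of "carrier G"] bij by (simp add: bij_betw_def)
  have sub: "derived G (carrier G) \<subseteq> carrier G"
    by (simp add: derived_in_carrier)
  have "f ` ab_class G x = (\<lambda>d. f d \<otimes> f x) ` derived G (carrier G)"
    using x sub unfolding ab_class_def r_coset_def by (auto simp: image_iff) (metis f.hom_mult subsetD)+
  also have "\<dots> = ab_class G (f x)"
    unfolding ab_class_def r_coset_def by (subst (2) img[symmetric]) auto
  finally show ?thesis .
qed

end


section \<open>Presented groups\<close>

lemma gw_eq_context: "gw_eq R u v \<Longrightarrow> gw_eq R (a @ u @ b) (a @ v @ b)"
proof (induction rule: gw_eq.induct)
  case (cancel u x e v)
  show ?case
    using gw_eq.cancel[of R "a @ u" x e "v @ b"] by simp
next
  case (relator \<rho> u v)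
  thus ?case
    using gw_eq.relator[of \<rho> R "a @ u" "v @ b"] by simp
qed (auto intro: gw_eq.intros)

lemma gw_eq_append:
  assumes "gw_eq R u u'" "gw_eq R v v'"
  shows "gw_eq R (u @ v) (u' @ v')"
proof -
  have "gw_eq R (u @ v) (u' @ v)"
    using gw_eq_context[OF assms(1), of "[]" v] by simp
  moreover have "gw_eq R (u' @ v) (u' @ v')"
    using gw_eq_context[OF assms(2), of u' "[]"] by simp
  ultimately show ?thesis
    by (rule gw_eq.trans)
qed

lemma gw_class_eq_iff: "gw_class R u = gw_class R v \<longleftrightarrow> gw_eq R u v"
  unfolding gw_class_def by (auto intro: gw_eq.refl gw_eq.sym gw_eq.trans)

lemma carrier_presented_group: "carrier (presented_group R) = range (gw_class R)"
  and one_presented_group: "\<one>\<^bsub>presented_group R\<^esub> = gw_class R []"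
  by (simp_all add: presented_group_def)

lemma gw_class_closed [simp]: "gw_class R u \<in> carrier (presented_group R)"
  by (simp add: carrier_presented_group)

lemma mult_presented_group:
  "gw_class R u \<otimes>\<^bsub>presented_group R\<^esub> gw_class R v = gw_class R (u @ v)"
  unfolding presented_group_def gw_class_def
  by (auto intro: gw_eq.refl gw_eq_append gw_eq.trans)

lemma gw_inv_append_self: "gw_eq R (gw_inv u @ u) []"
proof (induction u)
  case (Cons a u)
  obtain x e where a: "a = (x, e)"
    by (cases a)
  \<comment> \<open>Inversion reverses the word, so the first letter of \<open>a # u\<close> meets
    its inverse in the middle, and this pair cancels first.\<close>
  have "gw_eq R (gw_inv (a # u) @ a # u) (gw_inv u @ u)"
    using gw_eq.cancel[of R "gw_inv u" x "\<not> e" u] by (simp add: gw_inv_def a)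
  with Cons show ?case
    by (blast intro: gw_eq.trans)
qed (simp add: gw_inv_def gw_eq.refl)

lemma group_presented_group: "group (presented_group R)"
proof (rule groupI)
  fix x assume "x \<in> carrier (presented_group R)"
  then obtain u where "x = gw_class R u"
    by (auto simp: carrier_presented_group)
  thus "\<exists>y\<in>carrier (presented_group R). y \<otimes>\<^bsub>presented_group R\<^esub> x = \<one>\<^bsub>presented_group R\<^esub>"
    by (intro bexI[of _ "gw_class R (gw_inv u)"])
      (simp_all add: mult_presented_group one_presented_group gw_class_eq_iff gw_inv_append_self)
qed (auto simp: carrier_presented_group one_presented_group mult_presented_group)

lemma inv_presented_group: "inv\<^bsub>presented_group R\<^esub> gw_class R u = gw_class R (gw_inv u)"
  by (rule group.inv_equality[OF group_presented_group])
    (simp_all add: mult_presented_group one_presented_group gw_class_eq_iff gw_inv_append_self)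

lemma commutator_presented_group:
  "commutator (presented_group R) (gw_class R u) (gw_class R v) = gw_class R (gw_comm u v)"
  by (simp add: commutator_def gw_comm_def inv_presented_group mult_presented_group)

lemma gw_class_relator: "\<rho> \<in> R \<Longrightarrow> gw_class R \<rho> = \<one>\<^bsub>presented_group R\<^esub>"
  using gw_eq.relator[of \<rho> R "[]" "[]"] by (simp add: one_presented_group gw_class_eq_iff)

lemma generate_presented_group:
  "generate (presented_group R) (range (\<lambda>x. gw_class R [(x, False)])) = carrier (presented_group R)"
    (is "generate ?P ?S = _")
proof
  interpret group ?P
    by (rule group_presented_group)
  show "generate ?P ?S \<subseteq> carrier ?P"
    by (intro generate_incl) auto
  have letter: "gw_class R [(x, e)] \<in> generate ?P ?S" for x e
  proof (cases e)
    case True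
    have "gw_class R [(x, e)] = inv\<^bsub>?P\<^esub> gw_class R [(x, False)]"
      using True by (simp add: inv_presented_group gw_inv_def)
    thus ?thesis
      by (auto intro: generate.inv)
  qed (auto intro: generate.incl)
  have "gw_class R u \<in> generate ?P ?S" for u
  proof (induction u)
    case Nil
    show ?case
      using generate.one[of ?P ?S] by (simp add: one_presented_group)
  next
    case (Cons a u)
    thus ?case
      using generate.eng[OF letter[of "fst a" "snd a"] Cons] by (simp add: mult_presented_group)
  qed
  thus "carrier ?P \<subseteq> generate ?P ?S"
    by (auto simp: carrier_presented_group)
qed

text \<open>The homomorphism from the free group to the integers with prescribed values on the
  generators, read off from words.\<close>

definition word_sum :: "('x \<Rightarrow> int) \<Rightarrow> 'x gword \<Rightarrow> int" where
  "word_sum \<phi> w = sum_list (map (\<lambda>(x, e). if e then - \<phi> x else \<phi> x) w)"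

lemma word_sum_simps [simp]:
  "word_sum \<phi> [] = 0"
  "word_sum \<phi> ((x, e) # w) = (if e then - \<phi> x else \<phi> x) + word_sum \<phi> w"
  "word_sum \<phi> (u @ v) = word_sum \<phi> u + word_sum \<phi> v"
  by (simp_all add: word_sum_def)

lemma word_sum_gw_inv: "word_sum \<phi> (gw_inv u) = - word_sum \<phi> u"
  by (induction u) (auto simp: gw_inv_def)

lemma word_sum_gw_comm [simp]: "word_sum \<phi> (gw_comm u v) = 0"
  by (simp add: gw_comm_def word_sum_gw_inv)

text \<open>The congruence is generated by free cancellation and the relators, so a sum vanishing on
  the relators is constant on classes and may be evaluated at any representative.\<close>

lemma presented_group_int_hom:
  assumes "\<And>\<rho>. \<rho> \<in> R \<Longrightarrow> word_sum \<phi> \<rho> = 0"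
  obtains h where "h \<in> hom (presented_group R) integer_group"
    "\<And>u. h (gw_class R u) = word_sum \<phi> u"
proof
  have inv: "gw_eq R u v \<Longrightarrow> word_sum \<phi> u = word_sum \<phi> v" for u v
    by (induction rule: gw_eq.induct) (use assms in auto)
  define h where "h A = word_sum \<phi> (SOME u. u \<in> A)" for A
  show h: "h (gw_class R u) = word_sum \<phi> u" for u
  proof -
    have "(SOME v. v \<in> gw_class R u) \<in> gw_class R u"
      by (rule someI[of _ u]) (simp add: gw_class_def gw_eq.refl)
    thus ?thesis
      using inv by (simp add: h_def gw_class_def)
  qed
  show "h \<in> hom (presented_group R) integer_group"
    by (rule homI) (auto simp: carrier_presented_group mult_presented_group h)
qed

section \<open>Commutators, centralisers and finite direct products\<close>

lemma (in group) commutator_swap: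
  assumes "x \<in> carrier G" "y \<in> carrier G"
  shows "x \<otimes> y = commutator G x y \<otimes> (y \<otimes> x)"
proof -
  have "inv y \<otimes> (y \<otimes> x) = x"
    using assms by (simp flip: m_assoc)
  thus ?thesis
    using assms by (simp add: commutator_def m_assoc)
qed

lemma (in group) commutator_closed [simp]:
  "\<lbrakk>x \<in> carrier G; y \<in> carrier G\<rbrakk> \<Longrightarrow> commutator G x y \<in> carrier G"
  by (simp add: commutator_def)

lemma (in group_hom) hom_commutator:
  "\<lbrakk>x \<in> carrier G; y \<in> carrier G\<rbrakk> \<Longrightarrow> h (commutator G x y) = commutator H (h x) (h y)"
  by (simp add: commutator_def)

text \<open>The elements commuting with \<open>z\<close> are closed under products and inverses, so
  centrality has to be checked on generators only.\<close>

lemma (in group) commutes_generate: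
  assumes "S \<subseteq> carrier G" "z \<in> carrier G" and z: "\<And>s. s \<in> S \<Longrightarrow> s \<otimes> z = z \<otimes> s"
    and "x \<in> generate G S"
  shows "x \<otimes> z = z \<otimes> x"
  using \<open>x \<in> generate G S\<close>
proof (induction rule: generate.induct)
  case one
  show ?case using assms by simp
next
  case (incl s)
  thus ?case by (rule z)
next
  case (inv s)
  hence s: "s \<in> carrier G"
    using assms by blast
  have "z = inv s \<otimes> (s \<otimes> z)"
    using s assms(2) by (simp flip: m_assoc)
  also have "\<dots> = inv s \<otimes> z \<otimes> s"
    using z[OF inv] s assms(2) by (simp add: m_assoc)
  finally show ?case
    using s assms(2) by (metis inv_closed inv_solve_right m_closed)
next
  case (eng x y)
  have "x \<in> carrier G" "y \<in> carrier G"
    using eng generate_in_carrier[OF assms(1)] by auto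
  thus ?case
    using eng assms(2) by (metis m_assoc)
qed

lemma subgroup_product_group_eq:
  assumes "finite I" and G: "\<And>i. i \<in> I \<Longrightarrow> group (G i)" and K: "subgroup K (product_group I G)"
    and factor: "\<And>i x. \<lbrakk>i \<in> I; x \<in> carrier (G i)\<rbrakk>
      \<Longrightarrow> (\<lambda>j\<in>I. if j = i then x else \<one>\<^bsub>G j\<^esub>) \<in> K"
  shows "K = carrier (product_group I G)"
proof
  show "K \<subseteq> carrier (product_group I G)"
    using K by (rule subgroup.subset)
  show "carrier (product_group I G) \<subseteq> K"
  proof
    fix t assume t: "t \<in> carrier (product_group I G)"
    \<comment> \<open>The tuple is filled in one coordinate at a time: \<open>J\<close> holds the
      finished coordinates, the others are still trivial.\<close>
    have "(\<lambda>j\<in>I. if j \<in> J then t j else \<one>\<^bsub>G j\<^esub>) \<in> K" if "J \<subseteq> I" for J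
      using finite_subset[OF that \<open>finite I\<close>] that
    proof (induction J)
      case empty
      show ?case
        using subgroup.one_closed[OF K] by (simp add: restrict_def)
    next
      case (insert i J)
      have "(\<lambda>j\<in>I. if j \<in> insert i J then t j else \<one>\<^bsub>G j\<^esub>) =
          (\<lambda>j\<in>I. if j \<in> J then t j else \<one>\<^bsub>G j\<^esub>) \<otimes>\<^bsub>product_group I G\<^esub>
          (\<lambda>j\<in>I. if j = i then t i else \<one>\<^bsub>G j\<^esub>)"
        using insert t
        by (auto simp: fun_eq_iff restrict_def PiE_iff group.is_monoid[OF G] monoid.l_one monoid.r_one
            intro!: monoid.r_one[symmetric] monoid.l_one[symmetric])
      moreover have "(\<lambda>j\<in>I. if j = i then t i else \<one>\<^bsub>G j\<^esub>) \<in> K"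
        using insert t by (intro factor) (auto simp: PiE_iff)
      moreover have "(\<lambda>j\<in>I. if j \<in> J then t j else \<one>\<^bsub>G j\<^esub>) \<in> K"
        by (rule insert.IH) (use insert.prems in simp)
      ultimately show ?case
        by (simp only: subgroup.m_closed[OF K])
    qed
    from this[of I] have "(\<lambda>j\<in>I. t j) \<in> K"
      by (simp cong: restrict_cong)
    thus "t \<in> K"
      using t by (simp add: PiE_restrict)
  qed
qed

section \<open>The groups \<open>H\<^sub>1\<close> and \<open>H\<^sub>D\<close>\<close>

lemma group_H1: "group H1"
  by (simp add: H1_def group_presented_group)

lemma H1_gen_closed [simp]: "H1_gen x \<in> carrier H1"
  by (simp add: H1_def H1_gen_def)

lemma generate_H1: "generate H1 (range H1_gen) = carrier H1"
  using generate_presented_group[of H1_relators]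
  unfolding H1_def H1_gen_def[abs_def] .

text \<open>The two relators say that \<open>?c\<close> commutes with either generator, and this
  extends to the generated group.\<close>

lemma H1_commutator_central:
  assumes "x \<in> carrier H1"
  shows "x \<otimes>\<^bsub>H1\<^esub> commutator H1 (H1_gen GenA) (H1_gen GenB) =
    commutator H1 (H1_gen GenA) (H1_gen GenB) \<otimes>\<^bsub>H1\<^esub> x" (is "_ \<otimes>\<^bsub>_\<^esub> ?c = _")
proof -
  interpret group H1
    by (rule group_H1)
  have "commutator H1 ?c (H1_gen x) = \<one>\<^bsub>H1\<^esub>" for x
    unfolding H1_def H1_gen_def commutator_presented_group
    by (rule gw_class_relator) (cases x; simp add: H1_relators_def)
  hence comm: "H1_gen x \<otimes>\<^bsub>H1\<^esub> ?c = ?c \<otimes>\<^bsub>H1\<^esub> H1_gen x" for x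
    using commutator_swap[of ?c "H1_gen x"] by simp
  show ?thesis
  proof (rule commutes_generate)
    show "range H1_gen \<subseteq> carrier H1" "?c \<in> carrier H1"
      by auto
    show "x \<in> generate H1 (range H1_gen)"
      using assms by (simp only: generate_H1)
  qed (use comm in blast)
qed

text \<open>Both relators are commutators, and the exponent sum of a commutator word is
  zero.\<close>

lemma H1_exponent_sum:
  obtains h where "h \<in> hom H1 integer_group" "\<And>x. h (H1_gen x) = (if x = y then 1 else 0)"
proof -
  let ?\<phi> = "\<lambda>x. if x = y then 1 else 0 :: int"
  have "word_sum ?\<phi> \<rho> = 0" if "\<rho> \<in> H1_relators" for \<rho>
    using that by (auto simp: H1_relators_def)
  then obtain h where h: "h \<in> hom (presented_group H1_relators) integer_group"
    "\<And>u. h (gw_class H1_relators u) = word_sum ?\<phi> u"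
    by (rule presented_group_int_hom) blast+
  show thesis
    by (rule that[of h]) (use h in \<open>auto simp: H1_def H1_gen_def\<close>)
qed

section \<open>Direct powers of \<open>H1\<close>\<close>

lemma group_H1_power: "group (H1_power r)"
  by (simp add: H1_power_def group_H1)

lemma carrier_H1_power: "carrier (H1_power r) = (\<Pi>\<^sub>E i\<in>{1..r}. carrier H1)"
  and mult_H1_power: "t \<otimes>\<^bsub>H1_power r\<^esub> u = (\<lambda>i\<in>{1..r}. t i \<otimes>\<^bsub>H1\<^esub> u i)"
  by (simp_all add: H1_power_def)

text \<open>For \<open>i\<close> outside \<open>{1..r}\<close> this map is trivial, so it is a
  homomorphism for every index.\<close>

definition factor_embedding :: "nat \<Rightarrow> nat \<Rightarrow> heis_gen gword set \<Rightarrow> heis_tuple" where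
  "factor_embedding r i x = (\<lambda>j\<in>{1..r}. if j = i then x else \<one>\<^bsub>H1\<^esub>)"

lemma factor_embedding_hom: "factor_embedding r i \<in> hom H1 (H1_power r)"
proof -
  interpret group H1
    by (rule group_H1)
  show ?thesis
    by (rule homI)
      (auto simp: factor_embedding_def carrier_H1_power mult_H1_power fun_eq_iff restrict_def)
qed

lemma group_hom_factor_embedding: "group_hom H1 (H1_power r) (factor_embedding r i)"
  by (simp add: group_hom_def group_hom_axioms_def group_H1 group_H1_power factor_embedding_hom)

lemma copy_gen_eq: "copy_gen r i x = factor_embedding r i (H1_gen x)"
  by (simp add: copy_gen_def factor_embedding_def)

lemma copy_gen_closed [simp]: "copy_gen r i x \<in> carrier (H1_power r)"
  using group_hom.hom_closed[OF group_hom_factor_embedding] by (simp add: copy_gen_eq)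

lemma copy_c_eq: "copy_c r i = factor_embedding r i (commutator H1 (H1_gen GenA) (H1_gen GenB))"
  by (simp add: copy_c_def copy_gen_eq group_hom.hom_commutator[OF group_hom_factor_embedding])

lemma copy_c_closed [simp]: "copy_c r i \<in> carrier (H1_power r)"
  by (simp add: copy_c_def group.commutator_closed[OF group_H1_power])

lemma copy_c_central:
  assumes "t \<in> carrier (H1_power r)"
  shows "t \<otimes>\<^bsub>H1_power r\<^esub> copy_c r i = copy_c r i \<otimes>\<^bsub>H1_power r\<^esub> t"
proof -
  interpret group H1
    by (rule group_H1)
  show ?thesis
    using assms
    by (auto simp: copy_c_eq factor_embedding_def mult_H1_power carrier_H1_power H1_commutator_central
        fun_eq_iff restrict_def PiE_iff)
qed

lemma copy_gen_commute:
  assumes "p \<noteq> q"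
  shows "copy_gen r p x \<otimes>\<^bsub>H1_power r\<^esub> copy_gen r q y = copy_gen r q y \<otimes>\<^bsub>H1_power r\<^esub> copy_gen r p x"
proof -
  interpret group H1
    by (rule group_H1)
  show ?thesis
    using assms by (auto simp: copy_gen_def mult_H1_power fun_eq_iff restrict_def)
qed

lemma generate_copy_gen:
  "generate (H1_power r) {copy_gen r i x | i x. i \<in> {1..r}} = carrier (H1_power r)"
    (is "generate _ ?S = _")
proof -
  interpret group "H1_power r"
    by (rule group_H1_power)
  have K: "subgroup (generate (H1_power r) ?S) (H1_power r)"
    by (intro generate_is_subgroup) auto
  have "factor_embedding r i x \<in> generate (H1_power r) ?S"
    if "i \<in> {1..r}" "x \<in> carrier H1" for i x
  proof -
    \<comment> \<open>Homomorphic images of generated subgroups are generated by the images, so a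
      whole factor is reached from its two generators.\<close>
    have "factor_embedding r i ` generate H1 (range H1_gen)
        = generate (H1_power r) (factor_embedding r i ` range H1_gen)"
      by (rule group_hom.generate_img[OF group_hom_factor_embedding, symmetric]) auto
    also have "\<dots> \<subseteq> generate (H1_power r) ?S"
      by (rule mono_generate) (use that in \<open>auto simp: copy_gen_eq\<close>)
    finally show ?thesis
      using that generate_H1 by blast
  qed
  thus ?thesis
    using subgroup_product_group_eq[of "{1..r}" "\<lambda>_. H1", OF _ group_H1] K
    by (simp add: H1_power_def factor_embedding_def)
qed

section \<open>The quotient of the direct power by the central relations\<close>

definition HD_relations :: "nat \<Rightarrow> (nat \<Rightarrow> nat) \<Rightarrow> heis_tuple set" where
  "HD_relations r D =
    {copy_c r i \<otimes>\<^bsub>H1_power r\<^esub> (copy_c r 1 [^]\<^bsub>H1_power r\<^esub> (- int (D (i - 1)))) | i. i \<in> {2..r}}"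

lemma HD_subgroup_eq: "HD_subgroup r D = generate (H1_power r) (HD_relations r D)"
  by (simp add: HD_subgroup_def HD_relations_def)

lemma HD_relations_subset: "HD_relations r D \<subseteq> carrier (H1_power r)"
proof -
  interpret group "H1_power r"
    by (rule group_H1_power)
  show ?thesis
    by (auto simp: HD_relations_def)
qed

text \<open>The relations are products of powers of central elements, so conjugation fixes each of
  them, and a set invariant under conjugation generates a normal subgroup.\<close>

lemma HD_subgroup_normal: "HD_subgroup r D \<lhd> H1_power r"
proof -
  interpret P: group "H1_power r"
    by (rule group_H1_power)
  show ?thesis
    unfolding HD_subgroup_eq
  proof (rule P.normal_generateI[OF HD_relations_subset])
    fix h t assume h: "h \<in> HD_relations r D" and t: "t \<in> carrier (H1_power r)"
    have "t \<otimes>\<^bsub>H1_power r\<^esub> copy_c r 1 [^]\<^bsub>H1_power r\<^esub> k = copy_c r 1 [^]\<^bsub>H1_power r\<^esub> k \<otimes>\<^bsub>H1_power r\<^esub> t"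
      for k :: int
      by (rule P.int_pow_commute) (simp_all add: t copy_c_central)
    hence "t \<otimes>\<^bsub>H1_power r\<^esub> h = h \<otimes>\<^bsub>H1_power r\<^esub> t"
      using h t copy_c_central[OF t] unfolding HD_relations_def
      by (auto simp: P.m_assoc) (metis P.int_pow_closed P.m_assoc copy_c_closed)
    moreover have "h \<in> carrier (H1_power r)"
      using h HD_relations_subset by blast
    ultimately show "t \<otimes>\<^bsub>H1_power r\<^esub> h \<otimes>\<^bsub>H1_power r\<^esub> inv\<^bsub>H1_power r\<^esub> t \<in> HD_relations r D"
      using h t by (simp add: P.m_assoc)
  qed
qed

lemma group_HD: "group (HD r D)"
  unfolding HD_def by (rule normal.factorgroup_is_group[OF HD_subgroup_normal])

abbreviation HD_proj :: "nat \<Rightarrow> (nat \<Rightarrow> nat) \<Rightarrow> heis_tuple \<Rightarrow> heis_tuple set" where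
  "HD_proj r D t \<equiv> HD_subgroup r D #>\<^bsub>H1_power r\<^esub> t"

lemma group_hom_HD_proj: "group_hom (H1_power r) (HD r D) (HD_proj r D)"
  using normal.r_coset_hom_Mod[OF HD_subgroup_normal, of r D] group_HD[of r D]
  by (simp add: group_hom_def group_hom_axioms_def group_H1_power HD_def)

lemma carrier_HD: "carrier (HD r D) = HD_proj r D ` carrier (H1_power r)"
  by (simp add: HD_def carrier_FactGroup)

text \<open>A defining relation becomes trivial in the quotient and can be solved there for the
  commutator of the \<open>i\<close>-th copy.\<close>

lemma HD_proj_copy_c:
  assumes "i \<in> {2..r}"
  shows "HD_proj r D (copy_c r i) = HD_proj r D (copy_c r 1) [^]\<^bsub>HD r D\<^esub> int (D (i - 1))"
proof -
  interpret P: group "H1_power r"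
    by (rule group_H1_power)
  interpret Q: group "HD r D"
    by (rule group_HD)
  interpret \<pi>: group_hom "H1_power r" "HD r D" "HD_proj r D"
    by (rule group_hom_HD_proj)
  let ?k = "int (D (i - 1))"
  let ?\<rho> = "copy_c r i \<otimes>\<^bsub>H1_power r\<^esub> (copy_c r 1 [^]\<^bsub>H1_power r\<^esub> (- ?k))"
  have "?\<rho> \<in> HD_relations r D"
    using assms by (auto simp: HD_relations_def)
  hence "?\<rho> \<in> HD_subgroup r D" and "subgroup (HD_subgroup r D) (H1_power r)"
    using HD_relations_subset by (auto simp: HD_subgroup_eq intro: generate.incl P.generate_is_subgroup)
  hence "\<one>\<^bsub>HD r D\<^esub> = HD_proj r D ?\<rho>"
    by (subst P.coset_join2) (auto simp: HD_def)
  also have "HD_proj r D ?\<rho>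
      = HD_proj r D (copy_c r i) \<otimes>\<^bsub>HD r D\<^esub> inv\<^bsub>HD r D\<^esub> (HD_proj r D (copy_c r 1) [^]\<^bsub>HD r D\<^esub> ?k)"
    by (simp add: \<pi>.hom_int_pow Q.int_pow_neg)
  finally have "HD_proj r D (copy_c r i) \<otimes>\<^bsub>HD r D\<^esub> inv\<^bsub>HD r D\<^esub> (HD_proj r D (copy_c r 1) [^]\<^bsub>HD r D\<^esub> ?k)
      = \<one>\<^bsub>HD r D\<^esub>" ..
  from this[THEN Q.inv_solve_right'[THEN iffD1, rotated -1]] show ?thesis
    using \<pi>.hom_closed[OF copy_c_closed] by simp
qed

text \<open>The exponent sum of a generator in one copy kills every commutator, so it descends to \<open>H\<^sub>D\<close>.\<close>

lemma HD_exponent_sum: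
  assumes "q \<in> {1..r}"
  obtains h where "h \<in> hom (HD r D) integer_group"
    "\<And>i x. h (HD_gen r D i x) = (if i = q \<and> x = y then 1 else 0)"
proof -
  interpret P: group "H1_power r"
    by (rule group_H1_power)
  obtain e where e: "e \<in> hom H1 integer_group" "\<And>x. e (H1_gen x) = (if x = y then 1 else 0)"
    using H1_exponent_sum[of y] by blast
  interpret e: group_hom H1 integer_group e
    by (simp add: group_hom_def group_hom_axioms_def group_H1 e)
  interpret p: group_hom "H1_power r" integer_group "\<lambda>t. e (t q)"
  proof -
    have "(\<lambda>t. e (t q)) \<in> hom (H1_power r) integer_group"
      using assms e.hom_mult by (intro homI) (auto simp: carrier_H1_power mult_H1_power PiE_iff)
    thus "group_hom (H1_power r) integer_group (\<lambda>t. e (t q))"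
      by (simp add: group_hom_def group_hom_axioms_def group_H1_power)
  qed
  have "e (copy_c r i q) = 0" for i
    by (simp add: copy_c_def p.hom_commutator) (simp add: commutator_def)
  hence "HD_relations r D \<subseteq> kernel (H1_power r) integer_group (\<lambda>t. e (t q))"
    using HD_relations_subset p.hom_int_pow
    by (auto simp: kernel_def HD_relations_def p.hom_mult)
  hence "HD_subgroup r D \<subseteq> kernel (H1_power r) integer_group (\<lambda>t. e (t q))"
    unfolding HD_subgroup_eq by (intro P.generate_subgroup_incl p.subgroup_kernel)
  then obtain h where h: "h \<in> hom (HD r D) integer_group"
    "\<And>t. t \<in> carrier (H1_power r) \<Longrightarrow> h (HD_proj r D t) = e (t q)"
    using p.FactGroup_universal_kernel[OF HD_subgroup_normal] unfolding HD_def by metis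
  \<comment> \<open>For \<open>i \<noteq> q\<close> the coordinate of \<open>copy_gen r i x\<close>
    at \<open>q\<close> is the identity, where \<open>e\<close> vanishes; this also covers indices
    outside \<open>{1..r}\<close>.\<close>
  have "e \<one>\<^bsub>H1\<^esub> = 0"
    using e.hom_one by simp
  hence "h (HD_gen r D i x) = (if i = q \<and> x = y then 1 else 0)" for i x
    using assms by (simp add: HD_gen_def h e) (auto simp: copy_gen_def e)
  with h(1) show thesis
    using that by blast
qed


section \<open>Polynomial functions\<close>

text \<open>Sums over infinite sets are zero by convention, so finiteness gives the sum in
  \<open>poly_fun_deg_le\<close> its meaning. Every exponent is at most \<open>d\<close>, and only
  those below \<open>n\<close> can be nonzero.\<close>

lemma finite_exponent_vectors: "finite {m :: nat \<Rightarrow> nat. (\<forall>i\<ge>n. m i = 0) \<and> (\<Sum>i<n. m i) \<le> d}"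
proof (rule finite_subset)
  show "{m :: nat \<Rightarrow> nat. (\<forall>i\<ge>n. m i = 0) \<and> (\<Sum>i<n. m i) \<le> d}
      \<subseteq> {m. \<forall>i. (i \<in> {..<n} \<longrightarrow> m i \<in> {..d}) \<and> (i \<notin> {..<n} \<longrightarrow> m i = 0)}"
  proof clarsimp
    fix m :: "nat \<Rightarrow> nat" and i assume "sum m {..<n} \<le> d" "i < n"
    thus "m i \<le> d"
      using member_le_sum[of i "{..<n}" m] by simp
  qed
qed (intro finite_set_of_finite_funs, auto)

lemma poly_fun_deg_le_monomial:
  assumes "\<forall>i\<ge>n. m i = 0" "(\<Sum>i<n. m i) \<le> d"
  shows "poly_fun_deg_le n d (\<lambda>x. \<Prod>i<n. (x $ i) ^ m i)"
  unfolding poly_fun_deg_le_def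
proof (intro exI[of _ "\<lambda>m'. if m' = m then 1 else 0"] ballI)
  fix x :: "real vec"
  show "(\<Prod>i<n. (x $ i) ^ m i) = (\<Sum>m' | (\<forall>i\<ge>n. m' i = 0) \<and> (\<Sum>i<n. m' i) \<le> d.
      (if m' = m then 1 else 0) * (\<Prod>i<n. (x $ i) ^ m' i))"
    using assms finite_exponent_vectors[of n d] by (simp add: if_distrib[of "\<lambda>c. c * _"] cong: if_cong)
qed

lemma poly_fun_deg_le_zero: "poly_fun_deg_le n d (\<lambda>_. 0)"
  unfolding poly_fun_deg_le_def by (intro exI[of _ "\<lambda>_. 0"]) simp

lemma poly_fun_deg_le_add:
  assumes "poly_fun_deg_le n d p" "poly_fun_deg_le n d q"
  shows "poly_fun_deg_le n d (\<lambda>x. p x + q x)"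
proof -
  let ?S = "{m :: nat \<Rightarrow> nat. (\<forall>i\<ge>n. m i = 0) \<and> (\<Sum>i<n. m i) \<le> d}"
  from assms obtain A B where
    "\<forall>x\<in>carrier_vec n. p x = (\<Sum>m\<in>?S. A m * (\<Prod>i<n. (x $ i) ^ m i))"
    "\<forall>x\<in>carrier_vec n. q x = (\<Sum>m\<in>?S. B m * (\<Prod>i<n. (x $ i) ^ m i))"
    unfolding poly_fun_deg_le_def by blast
  hence "\<forall>x\<in>carrier_vec n. p x + q x = (\<Sum>m\<in>?S. (A m + B m) * (\<Prod>i<n. (x $ i) ^ m i))"
    by (simp add: sum.distrib distrib_right)
  thus ?thesis
    unfolding poly_fun_deg_le_def by (rule exI[of _ "\<lambda>m. A m + B m"])
qed

lemma poly_fun_deg_le_scale: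
  assumes "poly_fun_deg_le n d p"
  shows "poly_fun_deg_le n d (\<lambda>x. a * p x)"
proof -
  let ?S = "{m :: nat \<Rightarrow> nat. (\<forall>i\<ge>n. m i = 0) \<and> (\<Sum>i<n. m i) \<le> d}"
  from assms obtain A where
    "\<forall>x\<in>carrier_vec n. p x = (\<Sum>m\<in>?S. A m * (\<Prod>i<n. (x $ i) ^ m i))"
    unfolding poly_fun_deg_le_def by blast
  hence "\<forall>x\<in>carrier_vec n. a * p x = (\<Sum>m\<in>?S. (a * A m) * (\<Prod>i<n. (x $ i) ^ m i))"
    by (simp add: sum_distrib_left mult.assoc)
  thus ?thesis
    unfolding poly_fun_deg_le_def by (rule exI[of _ "\<lambda>m. a * A m"])
qed

lemma poly_fun_deg_le_sum:
  "\<lbrakk>finite A; \<And>a. a \<in> A \<Longrightarrow> poly_fun_deg_le n d (p a)\<rbrakk> \<Longrightarrow> poly_fun_deg_le n d (\<lambda>x. \<Sum>a\<in>A. p a x)"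
  by (induction A rule: finite_induct) (auto intro: poly_fun_deg_le_zero poly_fun_deg_le_add)

lemma poly_fun_deg_le_coord:
  assumes "k < n" "1 \<le> d"
  shows "poly_fun_deg_le n d (\<lambda>x. x $ k)"
proof -
  have "(\<Prod>i<n. (x $ i) ^ (if i = k then 1 else 0)) = x $ k" for x :: "real vec"
    using assms(1) by (simp add: if_distrib[of "\<lambda>m. _ ^ m"] cong: if_cong)
  thus ?thesis
    using poly_fun_deg_le_monomial[of n "\<lambda>i. if i = k then 1 else 0" d] assms by simp
qed

lemma poly_fun_deg_le_coord_mult:
  assumes "j < n" "k < n" "2 \<le> d"
  shows "poly_fun_deg_le n d (\<lambda>x. x $ j * x $ k)"
proof -
  \<comment> \<open>A sum of two unit vectors also covers \<open>j = k\<close>, where the exponent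
    becomes 2.\<close>
  let ?m = "\<lambda>i. (if i = j then 1 else 0) + (if i = k then 1 else 0 :: nat)"
  have "(\<Prod>i<n. (x $ i) ^ ?m i) = x $ j * x $ k" for x :: "real vec"
    using assms(1,2)
    by (simp only: power_add prod.distrib) (simp add: if_distrib[of "\<lambda>m. _ ^ m"] cong: if_cong)
  moreover have "(\<Sum>i<n. ?m i) \<le> d"
    using assms by (simp add: sum.distrib)
  ultimately show ?thesis
    using poly_fun_deg_le_monomial[of n ?m d] assms(1,2) by (simp only:) auto
qed

section \<open>The exponent polynomial over the reals\<close>

context class2_basis
begin

text \<open>The triangular number in \<open>\<gamma>\<close> is expanded into monomials, so that
  integer division disappears and the closure rules for \<open>poly_fun_deg_le\<close> apply summand
  by summand.\<close>

definition \<gamma>_real :: "(nat \<Rightarrow> nat \<Rightarrow> int) \<Rightarrow> (nat \<Rightarrow> int) \<Rightarrow> real vec \<Rightarrow> real" where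
  "\<gamma>_real A t x = (\<Sum>k<n. of_int (t k) * x $ k
     + (of_int (\<beta> n (A k) (A k)) / 2 * (x $ k * x $ k) + (- of_int (\<beta> n (A k) (A k)) / 2) * x $ k)
     + (\<Sum>i<k. of_int (\<beta> n (A i) (A k)) * (x $ i * x $ k)))"

lemma poly_fun_\<gamma>_real: "poly_fun_deg_le n 2 (\<gamma>_real A t)"
  unfolding \<gamma>_real_def
  by (intro poly_fun_deg_le_sum poly_fun_deg_le_add poly_fun_deg_le_scale poly_fun_deg_le_coord
      poly_fun_deg_le_coord_mult) auto

lemma \<gamma>_real_of_int:
  assumes "x \<in> carrier_vec n"
  shows "\<gamma>_real A t (map_vec real_of_int x) = of_int (\<gamma> A t n (\<lambda>i. x $ i))"
proof -
  have half: "real_of_int (a * (a - 1) div 2) = (of_int a * of_int a - of_int a) / 2" for a :: int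
  proof -
    \<comment> \<open>One of two consecutive integers is even, so the integer division is
      exact.\<close>
    have "even (a * (a - 1))"
      by auto
    hence "real_of_int (a * (a - 1) div 2) = of_int (a * (a - 1)) / 2"
      by (simp add: real_of_int_div)
    thus ?thesis
      by (simp add: algebra_simps)
  qed
  show ?thesis
    using assms unfolding \<gamma>_real_def \<gamma>_def of_int_sum of_int_add of_int_mult half
    by (intro sum.cong) (auto simp: field_simps)
qed

end

section \<open>The basis of \<open>\<Gamma> \<times> H\<^sub>D\<close>\<close>

text \<open>The quotient map to \<open>HD\<close> followed by the inclusion of the second factor. It
  need not be injective: its kernel is \<open>HD_subgroup r D\<close>. Computations in the direct
  power are transferred along it.\<close>

definition tuple_embedding ::
  "('g, 'm) monoid_scheme \<Rightarrow> nat \<Rightarrow> (nat \<Rightarrow> nat) \<Rightarrow> heis_tuple \<Rightarrow> 'g \<times> heis_tuple set" where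
  "tuple_embedding \<Gamma> r D t = (\<one>\<^bsub>\<Gamma>\<^esub>, HD_proj r D t)"

context
  fixes \<Gamma> :: "('g, 'm) monoid_scheme"
    and s r :: nat
    and D :: "nat \<Rightarrow> nat"
    and z :: "nat \<Rightarrow> 'g"
  assumes \<Gamma>: "comm_group \<Gamma>" and r: "r \<ge> 1" and z: "is_basis \<Gamma> s z"
begin

interpretation \<Gamma>: comm_group \<Gamma>
  by (rule \<Gamma>)

interpretation P: group "H1_power r"
  by (rule group_H1_power)

interpretation Q: group "HD r D"
  by (rule group_HD)

interpretation N: group "NG \<Gamma> r D"
  unfolding NG_def by (rule DirProd_group) unfold_locales

abbreviation (input) "\<iota> \<equiv> tuple_embedding \<Gamma> r D"
abbreviation (input) "gen \<equiv> N_gen \<Gamma> s z r D"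
abbreviation (input) "cc \<equiv> N_c \<Gamma> r D"
abbreviation (input) "NN \<equiv> NG \<Gamma> r D"

interpretation \<iota>: group_hom "H1_power r" NN \<iota>
proof -
  interpret \<pi>: group_hom "H1_power r" "HD r D" "HD_proj r D"
    by (rule group_hom_HD_proj)
  have "\<iota> \<in> hom (H1_power r) NN"
    by (rule homI) (auto simp: tuple_embedding_def NG_def)
  thus "group_hom (H1_power r) NN \<iota>"
    by (simp add: group_hom_def group_hom_axioms_def P.is_group N.is_group)
qed

section \<open>Generators of \<open>NG\<close> and their commutation\<close>

lemma z_closed: "i \<in> {1..s} \<Longrightarrow> z i \<in> carrier \<Gamma>"
  using z by (auto simp: is_basis_def int_independent_def)

lemma gen_Gamma: "k < s \<Longrightarrow> gen k = (z (k + 1), \<one>\<^bsub>HD r D\<^esub>)"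
  by (simp add: N_gen_def)

lemma gen_copy:
  "s \<le> k \<Longrightarrow> gen k = \<iota> (copy_gen r ((k - s) div 2 + 1) (if even (k - s) then GenA else GenB))"
  by (simp add: N_gen_def tuple_embedding_def HD_gen_def)

lemma copy_index: "\<lbrakk>s \<le> k; k < 2 * r + s\<rbrakk> \<Longrightarrow> (k - s) div 2 + 1 \<in> {1..r}"
  by auto

lemma gen_closed: "k < 2 * r + s \<Longrightarrow> gen k \<in> carrier NN"
proof (cases "k < s")
  case True
  thus ?thesis
    using z_closed[of "k + 1"] by (simp add: gen_Gamma NG_def)
next
  case False
  thus ?thesis
    by (simp only: not_less gen_copy \<iota>.hom_closed copy_gen_closed)
qed

lemma cc_eq: "cc = \<iota> (copy_c r 1)"
  by (simp add: N_c_def copy_c_def \<iota>.hom_commutator) (simp add: tuple_embedding_def HD_gen_def)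

lemma cc_closed: "cc \<in> carrier NN"
  by (simp only: cc_eq \<iota>.hom_closed copy_c_closed)

lemma generate_gen: "generate NN (gen ` {..<2 * r + s}) = carrier NN"
proof
  let ?S = "gen ` {..<2 * r + s}"
  show "generate NN ?S \<subseteq> carrier NN"
    by (intro N.generate_incl) (auto simp: gen_closed)
  have K: "subgroup (generate NN ?S) NN"
    by (intro N.generate_is_subgroup) (auto simp: gen_closed)
  have left: "(x, \<one>\<^bsub>HD r D\<^esub>) \<in> generate NN ?S" if "x \<in> carrier \<Gamma>" for x
  proof -
    interpret e: group_hom \<Gamma> NN "\<lambda>x. (x, \<one>\<^bsub>HD r D\<^esub>)"
    proof -
      have "(\<lambda>x. (x, \<one>\<^bsub>HD r D\<^esub>)) \<in> hom \<Gamma> NN"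
        by (rule homI) (auto simp: NG_def)
      thus "group_hom \<Gamma> NN (\<lambda>x. (x, \<one>\<^bsub>HD r D\<^esub>))"
        by (simp add: group_hom_def group_hom_axioms_def \<Gamma>.is_group N.is_group)
    qed
    have "(\<lambda>x. (x, \<one>\<^bsub>HD r D\<^esub>)) ` generate \<Gamma> (z ` {1..s})
        = generate NN ((\<lambda>x. (x, \<one>\<^bsub>HD r D\<^esub>)) ` z ` {1..s})"
      by (rule e.generate_img[symmetric]) (auto simp: z_closed)
    also have "\<dots> \<subseteq> generate NN ?S"
    proof (rule N.mono_generate, clarify)
      fix i assume "i \<in> {1..s}"
      \<comment> \<open>The basis of \<open>\<Gamma>\<close> is numbered from 1, the coordinates
        from 0.\<close>
      hence "(z i, \<one>\<^bsub>HD r D\<^esub>) = gen (i - 1)" "i - 1 < 2 * r + s"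
        by (auto simp: gen_Gamma)
      thus "(z i, \<one>\<^bsub>HD r D\<^esub>) \<in> ?S"
        by blast
    qed
    finally show ?thesis
      using z that by (auto simp: is_basis_def)
  qed
  have right: "\<iota> t \<in> generate NN ?S" if "t \<in> carrier (H1_power r)" for t
  proof -
    let ?T = "{copy_gen r i x | i x. i \<in> {1..r}}"
    have "\<iota> ` generate (H1_power r) ?T = generate NN (\<iota> ` ?T)"
      by (rule \<iota>.generate_img[symmetric]) auto
    also have "\<dots> \<subseteq> generate NN ?S"
    proof (rule N.mono_generate, rule subsetI)
      fix y assume "y \<in> \<iota> ` ?T"
      then obtain i x where y: "y = \<iota> (copy_gen r i x)" "i \<in> {1..r}"
        by blast
      \<comment> \<open>This inverts the numbering in \<open>N_gen\<close>: the generators of copy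
        \<open>i\<close> occupy the position \<open>s + 2 * (i - 1)\<close> and the one after
        it.\<close>
      hence "y = gen (s + 2 * (i - 1) + (if x = GenA then 0 else 1))"
        "s + 2 * (i - 1) + (if x = GenA then 0 else 1) < 2 * r + s"
        by (cases x; auto simp: gen_copy)+
      thus "y \<in> ?S"
        by blast
    qed
    finally show ?thesis
      using that generate_copy_gen by blast
  qed
  show "carrier NN \<subseteq> generate NN ?S"
  proof
    fix y assume "y \<in> carrier NN"
    then obtain x t where y: "y = (x, HD_proj r D t)" "x \<in> carrier \<Gamma>" "t \<in> carrier (H1_power r)"
      by (auto simp: NG_def carrier_HD)
    have "HD_proj r D t \<in> carrier (HD r D)"
      using y by (auto simp: carrier_HD)
    hence "y = (x, \<one>\<^bsub>HD r D\<^esub>) \<otimes>\<^bsub>NN\<^esub> \<iota> t"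
      using y by (simp add: NG_def tuple_embedding_def)
    thus "y \<in> generate NN ?S"
      using left right y subgroup.m_closed[OF K] by simp
  qed
qed

lemma Gamma_central:
  assumes "x \<in> carrier \<Gamma>" "y \<in> carrier NN"
  shows "(x, \<one>\<^bsub>HD r D\<^esub>) \<otimes>\<^bsub>NN\<^esub> y = y \<otimes>\<^bsub>NN\<^esub> (x, \<one>\<^bsub>HD r D\<^esub>)"
  using assms by (auto simp: NG_def \<Gamma>.m_comm)

lemma cc_central:
  assumes "x \<in> carrier NN"
  shows "x \<otimes>\<^bsub>NN\<^esub> cc = cc \<otimes>\<^bsub>NN\<^esub> x"
proof (rule N.commutes_generate)
  show "x \<in> generate NN (gen ` {..<2 * r + s})"
    using assms by (simp only: generate_gen)
  show "gen ` {..<2 * r + s} \<subseteq> carrier NN"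
    by (auto simp: gen_closed)
  fix y assume "y \<in> gen ` {..<2 * r + s}"
  then obtain k where k: "y = gen k" "k < 2 * r + s"
    by blast
  show "y \<otimes>\<^bsub>NN\<^esub> cc = cc \<otimes>\<^bsub>NN\<^esub> y"
  proof (cases "k < s")
    case True
    thus ?thesis
      using Gamma_central[OF z_closed cc_closed, of "k + 1"] by (simp add: k gen_Gamma)
  next
    case False
    thus ?thesis
      using copy_c_central[OF copy_gen_closed]
      by (simp only: k not_less gen_copy cc_eq copy_gen_closed copy_c_closed flip: \<iota>.hom_mult)
  qed
qed (rule cc_closed)

text \<open>Here the defining relations of \<open>HD\<close> enter: they turn the commutators of all
  copies into powers of the single element \<open>cc\<close>.\<close>

lemma embedded_copy_c: "i \<in> {1..r} \<Longrightarrow> \<exists>k::int. \<iota> (copy_c r i) = cc [^]\<^bsub>NN\<^esub> k"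
proof (cases "i = 1")
  case True
  thus ?thesis
    by (intro exI[of _ 1]) (simp add: cc_eq)
next
  case False
  assume "i \<in> {1..r}"
  interpret e: group_hom "HD r D" NN "Pair \<one>\<^bsub>\<Gamma>\<^esub>"
  proof -
    have "Pair \<one>\<^bsub>\<Gamma>\<^esub> \<in> hom (HD r D) NN"
      by (rule homI) (auto simp: NG_def)
    thus "group_hom (HD r D) NN (Pair \<one>\<^bsub>\<Gamma>\<^esub>)"
      by (simp add: group_hom_def group_hom_axioms_def Q.is_group N.is_group)
  qed
  have "HD_proj r D (copy_c r 1) \<in> carrier (HD r D)"
    by (auto simp: carrier_HD)
  hence "\<iota> (copy_c r i) = cc [^]\<^bsub>NN\<^esub> int (D (i - 1))"
    using False \<open>i \<in> {1..r}\<close>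
    by (simp add: tuple_embedding_def cc_eq HD_proj_copy_c e.hom_int_pow)
  thus ?thesis ..
qed

text \<open>Only different generators of the same copy need a correction, which is a power of
  \<open>cc\<close> by \<open>embedded_copy_c\<close>; reversing their order negates its
  exponent.\<close>

lemma copy_gen_swap:
  assumes "p \<in> {1..r}" "q \<in> {1..r}"
  shows "\<exists>k::int. \<iota> (copy_gen r p x) \<otimes>\<^bsub>NN\<^esub> \<iota> (copy_gen r q y)
    = \<iota> (copy_gen r q y) \<otimes>\<^bsub>NN\<^esub> \<iota> (copy_gen r p x) \<otimes>\<^bsub>NN\<^esub> cc [^]\<^bsub>NN\<^esub> k"
proof (cases "p = q \<and> x \<noteq> y")
  case False
  hence "\<iota> (copy_gen r p x) \<otimes>\<^bsub>NN\<^esub> \<iota> (copy_gen r q y) = \<iota> (copy_gen r q y) \<otimes>\<^bsub>NN\<^esub> \<iota> (copy_gen r p x)"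
    using copy_gen_commute[of p q r x y] by (cases "p = q") (auto simp flip: \<iota>.hom_mult)
  thus ?thesis
    by (intro exI[of _ 0]) simp
next
  case True
  obtain k where k: "\<iota> (copy_c r p) = cc [^]\<^bsub>NN\<^esub> (k::int)"
    using embedded_copy_c assms by blast
  let ?a = "\<iota> (copy_gen r p GenA)" and ?b = "\<iota> (copy_gen r p GenB)"
  have "?a \<otimes>\<^bsub>NN\<^esub> ?b = commutator NN ?a ?b \<otimes>\<^bsub>NN\<^esub> (?b \<otimes>\<^bsub>NN\<^esub> ?a)"
    by (rule N.commutator_swap) auto
  also have "commutator NN ?a ?b = cc [^]\<^bsub>NN\<^esub> k"
    using k by (simp add: copy_c_def \<iota>.hom_commutator)
  also have "cc [^]\<^bsub>NN\<^esub> k \<otimes>\<^bsub>NN\<^esub> (?b \<otimes>\<^bsub>NN\<^esub> ?a) = ?b \<otimes>\<^bsub>NN\<^esub> ?a \<otimes>\<^bsub>NN\<^esub> cc [^]\<^bsub>NN\<^esub> k"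
    by (rule N.int_pow_commute[symmetric]) (auto simp: cc_closed cc_central)
  finally have ab: "?a \<otimes>\<^bsub>NN\<^esub> ?b = ?b \<otimes>\<^bsub>NN\<^esub> ?a \<otimes>\<^bsub>NN\<^esub> cc [^]\<^bsub>NN\<^esub> k" .
  hence ba: "?b \<otimes>\<^bsub>NN\<^esub> ?a = ?a \<otimes>\<^bsub>NN\<^esub> ?b \<otimes>\<^bsub>NN\<^esub> cc [^]\<^bsub>NN\<^esub> (- k)"
    by (simp add: N.m_assoc cc_closed flip: N.int_pow_mult)
  from True consider "x = GenA" "y = GenB" | "x = GenB" "y = GenA"
    by (cases x; cases y) auto
  thus ?thesis
    using ab ba True by cases blast+
qed

lemma gen_swap:
  assumes "i < 2 * r + s" "j < 2 * r + s"
  shows "\<exists>k::int. gen j \<otimes>\<^bsub>NN\<^esub> gen i = gen i \<otimes>\<^bsub>NN\<^esub> gen j \<otimes>\<^bsub>NN\<^esub> cc [^]\<^bsub>NN\<^esub> k"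
proof (cases "i < s \<or> j < s")
  case True
  hence "gen j \<otimes>\<^bsub>NN\<^esub> gen i = gen i \<otimes>\<^bsub>NN\<^esub> gen j"
    using Gamma_central[OF z_closed gen_closed[OF assms(1)], of "j + 1"]
      Gamma_central[OF z_closed gen_closed[OF assms(2)], of "i + 1"]
    by (auto simp: gen_Gamma)
  thus ?thesis
    using assms by (intro exI[of _ 0]) (simp add: gen_closed)
next
  case False
  hence "s \<le> i" "s \<le> j"
    by auto
  thus ?thesis
    unfolding gen_copy[OF \<open>s \<le> i\<close>] gen_copy[OF \<open>s \<le> j\<close>]
    using assms by (intro copy_gen_swap copy_index)
qed

lemma N_class2_basis: "\<exists>w. class2_basis NN gen cc (2 * r + s) w"
proof -
  \<comment> \<open>The range condition stands inside the existential so that \<open>w\<close> can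
    be chosen as a total function.\<close>
  have "\<forall>j i. \<exists>k::int. i < 2 * r + s \<and> j < 2 * r + s \<longrightarrow>
      gen j \<otimes>\<^bsub>NN\<^esub> gen i = gen i \<otimes>\<^bsub>NN\<^esub> gen j \<otimes>\<^bsub>NN\<^esub> cc [^]\<^bsub>NN\<^esub> k"
    using gen_swap by blast
  then obtain w :: "nat \<Rightarrow> nat \<Rightarrow> int" where "\<forall>j i. i < 2 * r + s \<and> j < 2 * r + s \<longrightarrow>
      gen j \<otimes>\<^bsub>NN\<^esub> gen i = gen i \<otimes>\<^bsub>NN\<^esub> gen j \<otimes>\<^bsub>NN\<^esub> cc [^]\<^bsub>NN\<^esub> w j i"
    by metis
  hence "class2_basis NN gen cc (2 * r + s) w"
    by (intro class2_basis.intro class2_basis_axioms.intro N.is_group gen_closed cc_closed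
        cc_central generate_gen) blast+
  thus ?thesis
    by (rule exI[of _ w])
qed

lemma N_free_class2_basis: "\<exists>w. free_class2_basis NN gen cc (2 * r + s) w"
proof -
  let ?n = "2 * r + s"
  obtain w where "class2_basis NN gen cc ?n w"
    using N_class2_basis by blast
  then interpret class2_basis NN gen cc ?n w .
  have indep: "u i = 0" if eq: "normal_word ?n u = cc [^]\<^bsub>NN\<^esub> (k::int)" and i: "i < ?n" for u k i
  proof (cases "i < s")
    case True
    have "fst \<in> hom NN \<Gamma>"
      by (rule homI) (auto simp: NG_def)
    then interpret fst: group_hom NN \<Gamma> fst
      by unfold_locales
    \<comment> \<open>Factors from position \<open>s\<close> on project trivially to
      \<open>\<Gamma>\<close>, hence the bound \<open>min m s\<close>; the shift
      \<open>i - 1\<close> passes from the numbering of the basis to that of the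
      coordinates.\<close>
    have fst_normal_word: "fst (normal_word m u) = (\<Otimes>\<^bsub>\<Gamma>\<^esub>i\<in>{1..min m s}. z i [^]\<^bsub>\<Gamma>\<^esub> u (i - 1))" if "m \<le> ?n" for m
      using that
    proof (induction m)
      case (Suc m)
      have step: "fst (normal_word (Suc m) u) = fst (normal_word m u) \<otimes>\<^bsub>\<Gamma>\<^esub> fst (gen m) [^]\<^bsub>\<Gamma>\<^esub> u m"
        using Suc.prems by (simp add: fst.hom_int_pow)
      show ?case
      proof (cases "m < s")
        case True
        have "{1..min (Suc m) s} = insert (Suc m) {1..min m s}"
          using True by auto
        moreover have "z \<in> {1..m} \<rightarrow> carrier \<Gamma>" "z (Suc m) \<in> carrier \<Gamma>"
          using z_closed True by auto
        ultimately show ?thesis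
          using Suc True step by (simp add: gen_Gamma \<Gamma>.m_comm Pi_iff)
      next
        case False
        hence "fst (gen m) = \<one>\<^bsub>\<Gamma>\<^esub>" "min (Suc m) s = min m s"
          by (auto simp: N_gen_def)
        moreover from this have "fst (normal_word (Suc m) u) = fst (normal_word m u)"
          using step Suc.prems fst.hom_closed[of "normal_word m u"] by (simp del: normal_word.simps)
        ultimately show ?thesis
          using Suc by (simp only:)
      qed
    qed simp
    have "fst (normal_word ?n u) = \<one>\<^bsub>\<Gamma>\<^esub>"
    proof -
      have "fst cc = \<one>\<^bsub>\<Gamma>\<^esub>"
        by (simp add: cc_eq tuple_embedding_def)
      thus ?thesis
        unfolding eq using fst.hom_int_pow[OF cc_closed, of k] by simp
    qed
    with fst_normal_word[of ?n] have prod: "(\<Otimes>\<^bsub>\<Gamma>\<^esub>i\<in>{1..s}. z i [^]\<^bsub>\<Gamma>\<^esub> u (i - 1)) = \<one>\<^bsub>\<Gamma>\<^esub>"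
      by (simp del: normal_word.simps)
    have "\<forall>l::nat \<Rightarrow> int. (\<Otimes>\<^bsub>\<Gamma>\<^esub>i\<in>{1..s}. z i [^]\<^bsub>\<Gamma>\<^esub> l i) = \<one>\<^bsub>\<Gamma>\<^esub> \<longrightarrow> (\<forall>i\<in>{1..s}. l i = 0)"
      using z unfolding is_basis_def int_independent_def by blast
    from spec[OF this, of "\<lambda>i. u (i - 1)"] prod have "\<forall>i\<in>{1..s}. u (i - 1) = 0"
      by simp
    thus ?thesis
      using True by (auto dest: bspec[of _ _ "Suc i"])
  next
    case False
    define q where "q = (i - s) div 2 + 1"
    define y where "y = (if even (i - s) then GenA else GenB)"
    have q: "q \<in> {1..r}"
      using False i by (auto simp: q_def)
    obtain h where h: "h \<in> hom (HD r D) integer_group"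
      "\<And>i x. h (HD_gen r D i x) = (if i = q \<and> x = y then 1 else 0)"
      using HD_exponent_sum[OF q] by blast
    interpret h: group_hom "HD r D" integer_group h
      by (simp add: group_hom_def group_hom_axioms_def Q.is_group h(1))
    have "(\<lambda>x. h (snd x)) \<in> hom NN integer_group"
      by (rule homI) (auto simp: NG_def)
    then interpret p: group_hom NN integer_group "\<lambda>x. h (snd x)"
      by (simp add: group_hom_def group_hom_axioms_def N.is_group)
    have gen: "h (snd (gen k)) = (if k = i then 1 else 0)" if "k < ?n" for k
    proof (cases "k < s")
      case True
      thus ?thesis
        using False h.hom_one by (simp add: gen_Gamma)
    next
      case k: False
      have "h (snd (gen k)) =
          (if (k - s) div 2 + 1 = q \<and> (if even (k - s) then GenA else GenB) = y then 1 else 0)"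
        using k by (simp add: N_gen_def h(2))
      \<comment> \<open>A number is determined by its half and its parity, so this exponent sum
        singles out position \<open>i\<close>.\<close>
      moreover have "(k - s) div 2 + 1 = q \<and> (if even (k - s) then GenA else GenB) = y \<longleftrightarrow> k = i"
        using bit_eq_rec[of "k - s" "i - s"] k False by (auto simp: q_def y_def)
      ultimately show ?thesis
        by simp
    qed
    have coord: "h (snd (normal_word m u)) = (if i < m then u i else 0)" if "m \<le> ?n" for m
      using that
    proof (induction m)
      case 0
      show ?case
        using p.hom_one by simp
    next
      case (Suc m)
      have "h (snd (normal_word (Suc m) u)) = h (snd (normal_word m u)) + u m * h (snd (gen m))"
        using Suc.prems p.hom_mult[of "normal_word m u" "gen m [^]\<^bsub>NN\<^esub> u m"]
          p.hom_int_pow[of "gen m" "u m"] by simp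
      with Suc show ?case
        by (cases "m = i") (auto simp: gen)
    qed
    \<comment> \<open>A commutator is killed by every homomorphism to the integers.\<close>
    have "h (snd cc) = 0"
      unfolding N_c_def using p.hom_commutator[OF gen_closed gen_closed]
      by (subst p.hom_commutator) (auto simp: NG_def HD_gen_def carrier_HD commutator_def)
    hence "h (snd (cc [^]\<^bsub>NN\<^esub> k)) = 0"
      using p.hom_int_pow[of cc k] by simp
    thus ?thesis
      using coord[of ?n] i eq by (simp del: normal_word.simps)
  qed
  moreover have "cc \<in> derived NN (carrier NN)"
  proof -
    have "HD_gen r D 1 x \<in> carrier (HD r D)" for x
      by (auto simp: HD_gen_def carrier_HD)
    hence "(\<one>\<^bsub>\<Gamma>\<^esub>, HD_gen r D 1 x) \<in> carrier NN" for x
      by (simp add: NG_def)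
    hence "cc \<in> derived_set NN (carrier NN)"
      unfolding N_c_def commutator_def by blast
    thus ?thesis
      unfolding derived_def by (rule generate.incl)
  qed
  ultimately have "free_class2_basis NN gen cc ?n w"
    by unfold_locales
  thus ?thesis
    by (rule exI[of _ w])
qed

end

section \<open>Automorphisms in Mal'cev coordinates\<close>

theorem proposition3p19:
  fixes \<Gamma> :: "('g, 'm) monoid_scheme"
    and s r :: nat
    and D :: "nat \<Rightarrow> nat"
    and z :: "nat \<Rightarrow> 'g"
    and f :: "'g \<times> heis_tuple set \<Rightarrow> 'g \<times> heis_tuple set"
  assumes "comm_group \<Gamma>"
    and "finitely_generated \<Gamma>"
    and "has_torsion_free_rank \<Gamma> s"
    and "r \<ge> 1"
    and "admissible r D"
    and "torsion_free (NG \<Gamma> r D)"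
    and "is_basis \<Gamma> s z"
    and "f \<in> auto (NG \<Gamma> r D)"
  shows "\<exists>\<epsilon>\<in>{1, -1 :: int}. \<exists>\<gamma> :: real vec \<Rightarrow> real.
    poly_fun_deg_le (2 * r + s) 2 \<gamma> \<and>
    \<gamma> (0\<^sub>v (2 * r + s)) = 0 \<and>
    (\<forall>x\<in>carrier_vec (2 * r + s). \<gamma> (map_vec real_of_int x) \<in> \<int>) \<and>
    (\<forall>x\<in>carrier_vec (2 * r + s). \<forall>k :: int.
      f (lift \<Gamma> s z r D x \<otimes>\<^bsub>NG \<Gamma> r D\<^esub> N_c \<Gamma> r D [^]\<^bsub>NG \<Gamma> r D\<^esub> k)
        = lift \<Gamma> s z r D
            (row_mult (ab_coords \<Gamma> s z r D (ab_class (NG \<Gamma> r D) (lift \<Gamma> s z r D x))) (theta \<Gamma> s z r D f))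
          \<otimes>\<^bsub>NG \<Gamma> r D\<^esub> N_c \<Gamma> r D [^]\<^bsub>NG \<Gamma> r D\<^esub> (\<epsilon> * k + \<lfloor>\<gamma> (map_vec real_of_int x)\<rfloor>) \<and>
      f (lift \<Gamma> s z r D x \<otimes>\<^bsub>NG \<Gamma> r D\<^esub> N_c \<Gamma> r D [^]\<^bsub>NG \<Gamma> r D\<^esub> k)
        = lift \<Gamma> s z r D (row_mult x (theta \<Gamma> s z r D f))
          \<otimes>\<^bsub>NG \<Gamma> r D\<^esub> N_c \<Gamma> r D [^]\<^bsub>NG \<Gamma> r D\<^esub> (\<epsilon> * k + \<lfloor>\<gamma> (map_vec real_of_int x)\<rfloor>))"
proof -
  let ?n = "2 * r + s" and ?N = "NG \<Gamma> r D"
  let ?g = "N_gen \<Gamma> s z r D" and ?c = "N_c \<Gamma> r D"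
  obtain w where "free_class2_basis ?N ?g ?c ?n w"
    using N_free_class2_basis assms by blast
  then interpret free_class2_basis ?N ?g ?c ?n w .
  have "f \<in> hom ?N ?N"
    using assms by (auto simp: auto_def)
  then interpret f: group_hom ?N ?N f
    by unfold_locales
  obtain \<epsilon> :: int where \<epsilon>: "\<epsilon> \<in> {1, -1}" "f ?c = ?c [^]\<^bsub>?N\<^esub> \<epsilon>"
    using automorphism_central[OF assms(8,6) c_derived] .
  let ?coords = "ab_coords \<Gamma> s z r D"
  have coords: "?coords (ab_class ?N x) \<in> carrier_vec ?n"
    "ab_class ?N x = power_prod (Ab ?N) (\<lambda>k. ab_class ?N (?g k)) (?coords (ab_class ?N x))"
    if "x \<in> carrier ?N" for x
    using theI'[OF coordinates_eq[OF that]] unfolding ab_coords_def by auto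
  have lift: "lift \<Gamma> s z r D x = normal_word ?n (\<lambda>i. x $ i)" if "x \<in> carrier_vec ?n" for x
    using that power_prod_eq_normal_word[of x] by (simp add: lift_def)
  \<comment> \<open>A canonical lift has its own exponent vector as coordinates, so the two formulas
    in the conclusion agree.\<close>
  have coords_lift: "?coords (ab_class ?N (lift \<Gamma> s z r D x)) = x" if "x \<in> carrier_vec ?n" for x
    unfolding ab_coords_def
    using that coordinates_eq[of "normal_word ?n (\<lambda>i. x $ i)"]
    by (intro the1_equality) (simp_all add: lift power_prod_ab_class)
  \<comment> \<open>These are the rows of \<open>theta\<close> as functions, the form in which
    \<open>hom_normal_word\<close> takes them.\<close>
  define A where "A k i = ?coords (f ` ab_class ?N (?g k)) $ i" for k i
  have "\<exists>t::int. f (?g k) = normal_word ?n (A k) \<otimes>\<^bsub>?N\<^esub> ?c [^]\<^bsub>?N\<^esub> t" if k: "k < ?n" for k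
  proof -
    have closed: "f (?g k) \<in> carrier ?N"
      using k by simp
    obtain u t where ut: "f (?g k) = normal_word ?n u \<otimes>\<^bsub>?N\<^esub> ?c [^]\<^bsub>?N\<^esub> (t::int)"
      using normal_form[OF closed] .
    have A: "A k = (\<lambda>i. ?coords (ab_class ?N (f (?g k))) $ i)"
      using k assms(8) by (simp add: A_def ab_class_image fun_eq_iff)
    have "ab_class ?N (normal_word ?n u \<otimes>\<^bsub>?N\<^esub> ?c [^]\<^bsub>?N\<^esub> t) = ab_class ?N (normal_word ?n (A k) \<otimes>\<^bsub>?N\<^esub> ?c [^]\<^bsub>?N\<^esub> (0::int))"
      using coords(2)[OF closed] power_prod_ab_class[OF coords(1)[OF closed]]
      by (simp add: A flip: ut)
    \<comment> \<open>Equality in the abelianisation fixes the exponents and leaves only the power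
      of \<open>c\<close> open, so \<open>f (?g k)\<close> has exponent vector
      \<open>A k\<close>.\<close>
    hence "normal_word ?n u = normal_word ?n (A k)"
      using ab_class_eqD by (intro normal_word_cong) blast
    thus ?thesis
      using ut by auto
  qed
  then obtain t :: "nat \<Rightarrow> int" where
    t: "\<And>k. k < ?n \<Longrightarrow> f (?g k) = normal_word ?n (A k) \<otimes>\<^bsub>?N\<^esub> ?c [^]\<^bsub>?N\<^esub> t k"
    by metis
  have main: "f (lift \<Gamma> s z r D x \<otimes>\<^bsub>?N\<^esub> ?c [^]\<^bsub>?N\<^esub> k)
      = lift \<Gamma> s z r D (row_mult x (theta \<Gamma> s z r D f)) \<otimes>\<^bsub>?N\<^esub>
        ?c [^]\<^bsub>?N\<^esub> (\<epsilon> * k + \<lfloor>\<gamma>_real A t (map_vec real_of_int x)\<rfloor>)"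
    if x: "x \<in> carrier_vec ?n" for x and k :: int
  proof -
    \<comment> \<open>The product with the matrix is the linear combination of rows that
      \<open>hom_normal_word\<close> produces.\<close>
    have row: "row_mult x (theta \<Gamma> s z r D f) = vec ?n (\<lambda>i. \<Sum>k<?n. x $ k * A k i)"
      using x coords(1)[of "f (?g _)"]
      by (auto simp: row_mult_def theta_def A_def scalar_prod_def mat_of_rows_def lessThan_atLeast0
          intro!: eq_vecI sum.cong)
    have "f (lift \<Gamma> s z r D x \<otimes>\<^bsub>?N\<^esub> ?c [^]\<^bsub>?N\<^esub> k)
        = f (normal_word ?n (\<lambda>i. x $ i)) \<otimes>\<^bsub>?N\<^esub> ?c [^]\<^bsub>?N\<^esub> (\<epsilon> * k)"
      by (simp add: lift[OF x] f.hom_int_pow \<epsilon> int_pow_pow)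
    also have "f (normal_word ?n (\<lambda>i. x $ i))
        = normal_word ?n (\<lambda>i. \<Sum>k<?n. x $ k * A k i) \<otimes>\<^bsub>?N\<^esub> ?c [^]\<^bsub>?N\<^esub> \<gamma> A t ?n (\<lambda>i. x $ i)"
      using hom_normal_word[OF \<open>f \<in> hom ?N ?N\<close> t order_refl] by simp
    also have "normal_word ?n (\<lambda>i. \<Sum>k<?n. x $ k * A k i) = lift \<Gamma> s z r D (row_mult x (theta \<Gamma> s z r D f))"
      unfolding row by (subst lift) (auto intro: normal_word_cong)
    finally have eq: "f (lift \<Gamma> s z r D x \<otimes>\<^bsub>?N\<^esub> ?c [^]\<^bsub>?N\<^esub> k)
        = lift \<Gamma> s z r D (row_mult x (theta \<Gamma> s z r D f)) \<otimes>\<^bsub>?N\<^esub> ?c [^]\<^bsub>?N\<^esub> \<gamma> A t ?n (\<lambda>i. x $ i)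
          \<otimes>\<^bsub>?N\<^esub> ?c [^]\<^bsub>?N\<^esub> (\<epsilon> * k)" .
    have closed: "lift \<Gamma> s z r D (row_mult x (theta \<Gamma> s z r D f)) \<in> carrier ?N"
      unfolding row by (subst lift) auto
    \<comment> \<open>At integer points the polynomial is integer valued, so the floor only changes
      the type.\<close>
    have floor: "\<lfloor>\<gamma>_real A t (map_vec real_of_int x)\<rfloor> = \<gamma> A t ?n (\<lambda>i. x $ i)"
      unfolding \<gamma>_real_of_int[OF x] by (rule floor_of_int)
    show ?thesis
      unfolding eq floor m_assoc[OF closed int_pow_closed[OF c_closed] int_pow_closed[OF c_closed]]
        int_pow_mult[OF c_closed, symmetric]
      by (simp only: add.commute)
  qed
  have "\<gamma>_real A t (0\<^sub>v ?n) = 0"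
    by (simp add: \<gamma>_real_def)
  moreover have "\<forall>x\<in>carrier_vec ?n. \<gamma>_real A t (map_vec real_of_int x) \<in> \<int>"
    by (simp add: \<gamma>_real_of_int)
  ultimately show ?thesis
    using \<epsilon>(1) main coords_lift poly_fun_\<gamma>_real
    by (intro bexI[of _ \<epsilon>] exI[of _ "\<gamma>_real A t"]) simp_all
qed

end
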